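(* Let $w: GL(n,\mathbb{R})^{+}\to\mathbb{R}$ be a $C^{2}$ function which is objective and isotropic, let $g:(0,\infty)^{n}\to\mathbb{R}$ be the symmetric $C^2$ function such that $w(F)=g(\sigma(F))$ for all $F$, let $h:\mathbb{R}^{n}\to\mathbb{R}$, $h(x)=g(\exp x_1,\dots,\exp x_n)$, and let $G(y)=(G_{ij}(y))$ and $H(y)=(H_{ij}(y))$, $y\in(0,\infty)^n$, be the symmetric $n\times n$ matrices associated with $g$ as defined in the context. Then $w$ is rank one convex if and only if both of the following conditions hold: (a) $h$ is Schur convex, and (b) for every $y\in(0,\infty)^{n}$ and every $x\in\mathbb{R}^{n}$, $$\sum_{i,j=1}^{n} H_{ij}(y)\,x_{i}x_{j}+\sum_{i,j=1}^{n}G_{ij}(y)\,|x_{i}|\,|x_{j}|\ \geq\ 0 .$$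
   Context: $GL(n,\mathbb{R})^{+}$ is the set of real $n\times n$ matrices with positive determinant. For $F\in GL(n,\mathbb{R})^+$, $\sigma(F)\in(0,\infty)^n$ is the vector of singular values of $F$ (eigenvalues of the square root of $F^{T}F$, with multiplicity). A function $w:GL(n,\mathbb{R})^+\to\mathbb{R}$ is objective if $w(QF)=w(F)$, and isotropic if $w(FQ)=w(F)$, for all $Q\in SO(n)$ and all $F\in GL(n,\mathbb{R})^+$. For an objective isotropic $w$ there is a symmetric (permutation invariant) function $g:(0,\infty)^n\to\mathbb{R}$ with $w(F)=g(\sigma(F))$; if $w$ is $C^2$ then so is $g$. A $C^{2}$ function $w$ is rank one convex if $$\sum_{i,j,k,l=1}^{n}\frac{\partial^{2}w}{\partial F_{ij}\partial F_{kl}}(F)\,a_{i}b_{j}a_{k}b_{l}\geq 0\quad\text{for all }F\in GL(n,\mathbb{R})^{+},\ a,b\in\mathbb{R}^{n};$$ equivalently, for all $A,B\in GL(n,\mathbb{R})^+$ with $\operatorname{rank}(A-B)=1$ and $(1-t)A+tB\in GL(n,\mathbb{R})^+$ for all $t\in[0,1]$, the function $t\in[0,1]\mapsto w((1-t)A+tB)$ is convex. For $x\in\mathbb{R}^n$, $x^{\downarrow}$ is the vector obtained by rearranging the coordinates of $x$ in decreasing order. One writes $x\prec y$ if $\sum_{j=1}^{k}x^{\downarrow}_{j}\le\sum_{j=1}^{k}y^{\downarrow}_{j}$ for $k=1,\dots,n$, with equality for $k=n$. A function $h:\mathbb{R}^n\to\mathbb{R}$ is Schur convex if $x\prec y$ implies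 $h(x)\le h(y)$. Write $g_i$, $g_{ij}$ for the first and second partial derivatives of $g$. For $y\in(0,\infty)^n$ and $i\neq j$ with $y_i\ne y_j$ put $$G_{ij}(y)=\frac{y_{i}g_{i}(y)-y_{j}g_{j}(y)}{y_{i}^{2}-y_{j}^{2}},\qquad \overline{H}_{ij}(y)=\frac{y_{j}g_{i}(y)-y_{i}g_{j}(y)}{y_{i}^{2}-y_{j}^{2}},$$ extended by continuity to points with $y_i=y_j$ (that is, if $y_i=y_j=t$, then $G_{ij}(y)=\frac{g_i(y)+t g_{ii}(y)-t g_{ij}(y)}{2t}$ and $\overline H_{ij}(y)=\frac{t g_{ii}(y)-t g_{ij}(y)-g_i(y)}{2t}$). Put $G_{ii}=0$ and $\overline{H}_{ii}=0$. Finally $H=\overline{H}+D^{2}g$, i.e. $H_{ij}(y)=\overline{H}_{ij}(y)+g_{ij}(y)$. *)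

theory Defs
  imports "HOL-Analysis.Analysis" "HOL-Library.Multiset"
begin

definition GL_pos :: "(real^'n^'n) set" where
  "GL_pos = {F. det F > 0}"

definition pos_orthant :: "(real^'n) set" where
  "pos_orthant = {y. \<forall>i. y $ i > 0}"

definition objective :: "(real^'n^'n \<Rightarrow> real) \<Rightarrow> bool" where
  "objective w \<longleftrightarrow> (\<forall>Q. rotation_matrix Q \<longrightarrow> (\<forall>F\<in>GL_pos. w (Q ** F) = w F))"

definition isotropic :: "(real^'n^'n \<Rightarrow> real) \<Rightarrow> bool" where
  "isotropic w \<longleftrightarrow> (\<forall>Q. rotation_matrix Q \<longrightarrow> (\<forall>F\<in>GL_pos. w (F ** Q) = w F))"

definition symmetric_on_pos :: "(real^'n \<Rightarrow> real) \<Rightarrow> bool" where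
  "symmetric_on_pos g \<longleftrightarrow> (\<forall>p. bij p \<longrightarrow> (\<forall>y\<in>pos_orthant. g (\<chi> i. y $ p i) = g y))"

definition psd_matrix :: "real^'n^'n \<Rightarrow> bool" where
  "psd_matrix P \<longleftrightarrow> transpose P = P \<and> (\<forall>x. x \<bullet> (P *v x) \<ge> 0)"

definition psd_sqrt :: "real^'n^'n \<Rightarrow> real^'n^'n" where
  "psd_sqrt A = (THE P. psd_matrix P \<and> P ** P = A)"

text \<open>
  The entries of \<open>s\<close> are the roots of the characteristic polynomial of \<open>A\<close>, each as often
  as its multiplicity.
\<close>

definition eigenvalue_vector :: "real^'n^'n \<Rightarrow> real^'n \<Rightarrow> bool" where
  "eigenvalue_vector A s \<longleftrightarrow> (\<forall>t. det (mat t - A) = (\<Prod>i\<in>UNIV. t - s $ i))"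

text \<open>
  The index type carries no order, so the vector of singular values is determined only up to a
  permutation of its entries; it is only used as the argument of permutation invariant functions.
\<close>

definition singular_values :: "real^'n^'n \<Rightarrow> real^'n" where
  "singular_values F = (SOME s. eigenvalue_vector (psd_sqrt (transpose F ** F)) s)"

text \<open>
  Meant for open \<open>S\<close>: \<open>f'\<close> and \<open>f''\<close> are the first and second Frechet derivatives of \<open>f\<close>.
\<close>

definition C2_on :: "'a::euclidean_space set \<Rightarrow> ('a \<Rightarrow> real) \<Rightarrow> bool" where
  "C2_on S f \<longleftrightarrow>
     (\<exists>(f' :: 'a \<Rightarrow> 'a \<Rightarrow>\<^sub>L real) (f'' :: 'a \<Rightarrow> 'a \<Rightarrow>\<^sub>L 'a \<Rightarrow>\<^sub>L real).
        (\<forall>x\<in>S. (f has_derivative blinfun_apply (f' x)) (at x)) \<and>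
        (\<forall>x\<in>S. (f' has_derivative blinfun_apply (f'' x)) (at x)) \<and>
        continuous_on S f'')"

definition dir_deriv :: "'a::real_normed_vector \<Rightarrow> ('a \<Rightarrow> real) \<Rightarrow> 'a \<Rightarrow> real" where
  "dir_deriv u f x = deriv (\<lambda>t. f (x + t *\<^sub>R u)) 0"

definition partial :: "'n \<Rightarrow> (real^'n \<Rightarrow> real) \<Rightarrow> real^'n \<Rightarrow> real" where
  "partial i = dir_deriv (axis i 1)"

definition partial_entry :: "'n \<Rightarrow> 'n \<Rightarrow> (real^'n^'n \<Rightarrow> real) \<Rightarrow> real^'n^'n \<Rightarrow> real" where
  "partial_entry i j = dir_deriv (axis i (axis j 1))"

definition rank_one_convex :: "(real^'n^'n \<Rightarrow> real) \<Rightarrow> bool" where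
  "rank_one_convex w \<longleftrightarrow>
     (\<forall>F\<in>GL_pos. \<forall>a b :: real^'n.
        (\<Sum>i\<in>UNIV. \<Sum>j\<in>UNIV. \<Sum>k\<in>UNIV. \<Sum>l\<in>UNIV.
           partial_entry i j (partial_entry k l w) F * a $ i * b $ j * a $ k * b $ l) \<ge> 0)"

definition decreasing_list :: "real^'n \<Rightarrow> real list" where
  "decreasing_list x = rev (sorted_list_of_multiset (image_mset (\<lambda>i. x $ i) (mset_set UNIV)))"

definition majorized :: "real^'n \<Rightarrow> real^'n \<Rightarrow> bool" (infix \<open>\<prec>\<close> 50) where
  "x \<prec> y \<longleftrightarrow>
     (\<forall>k\<in>{1..CARD('n)}. (\<Sum>j<k. decreasing_list x ! j) \<le> (\<Sum>j<k. decreasing_list y ! j)) \<and>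
     (\<Sum>j<CARD('n). decreasing_list x ! j) = (\<Sum>j<CARD('n). decreasing_list y ! j)"

definition schur_convex :: "(real^'n \<Rightarrow> real) \<Rightarrow> bool" where
  "schur_convex h \<longleftrightarrow> (\<forall>x y. x \<prec> y \<longrightarrow> h x \<le> h y)"

definition hessian :: "(real^'n \<Rightarrow> real) \<Rightarrow> real^'n \<Rightarrow> real^'n^'n" where
  "hessian g y = (\<chi> i j. partial i (partial j g) y)"

text \<open>
  In the next two definitions the branch \<open>y $ i = y $ j\<close> with \<open>i \<noteq> j\<close> is the continuous extension
  of the difference quotient, for \<open>g\<close> symmetric and twice continuously differentiable.
\<close>

definition G_matrix :: "(real^'n \<Rightarrow> real) \<Rightarrow> real^'n \<Rightarrow> real^'n^'n" where
  "G_matrix g y = (\<chi> i j.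
     if i = j then 0
     else if y $ i \<noteq> y $ j then
       (y $ i * partial i g y - y $ j * partial j g y) / ((y $ i)\<^sup>2 - (y $ j)\<^sup>2)
     else
       (partial i g y + y $ i * hessian g y $ i $ i - y $ i * hessian g y $ i $ j) / (2 * y $ i))"

definition H_bar_matrix :: "(real^'n \<Rightarrow> real) \<Rightarrow> real^'n \<Rightarrow> real^'n^'n" where
  "H_bar_matrix g y = (\<chi> i j.
     if i = j then 0
     else if y $ i \<noteq> y $ j then
       (y $ j * partial i g y - y $ i * partial j g y) / ((y $ i)\<^sup>2 - (y $ j)\<^sup>2)
     else
       (y $ i * hessian g y $ i $ i - y $ i * hessian g y $ i $ j - partial i g y) / (2 * y $ i))"

definition H_matrix :: "(real^'n \<Rightarrow> real) \<Rightarrow> real^'n \<Rightarrow> real^'n^'n" where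
  "H_matrix g y = H_bar_matrix g y + hessian g y"

end

theory Submission
  imports Defs
begin

text \<open>
  The function \<open>w\<close> is invariant under rotations from both sides, and every \<open>F\<close> with positive determinant
  is \<open>P ** diag_mat y ** Q\<close> with rotations \<open>P\<close>, \<open>Q\<close> and positive \<open>y\<close> (\<open>singular_value_decomposition\<close>).
  Rotations map rank one matrices to rank one matrices, so rank one convexity is a condition on the
  second derivative of \<open>w\<close> at diagonal matrices only (\<open>rank_one_convex_iff_diag\<close>).

  The second derivative at \<open>diag_mat y\<close> in a direction \<open>M\<close> is
  \[ \sum_{ij} g_{ij} M_{ii} M_{jj} + \sum_{ij} G_{ij} M_{ij}^2 + \sum_{ij} \bar H_{ij} M_{ij} M_{ji} \]
  (\<open>second_derivative_formula\<close>). For distinct \<open>y\<close> every \<open>M\<close> is the sum of a diagonal matrix, where \<open>w\<close>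
  is \<open>g\<close>, and of tangent vectors to the orbits of the rotation actions; differentiating the invariance
  twice expresses the derivatives in the latter by first derivatives of \<open>g\<close>. Repeated
  entries are reached as limits.

  For \<open>M $ i $ j = a $ i * b $ j\<close> and \<open>x $ i = a $ i * b $ i\<close> this is
  \[ \sum_{ij} H_{ij} x_i x_j + \sum_{ij} G_{ij} (a_i b_j)^2 . \]
  Coordinate vectors \<open>a\<close>, \<open>b\<close> show that nonnegativity forces \<open>G_{ij} \<ge> 0\<close>, and this is equivalent to
  Schur convexity of \<open>h\<close>: the numerator of \<open>G_{ij}\<close> is the difference of two partial derivatives of
  \<open>h\<close> (\<open>schur_convexI\<close>, \<open>schur_convexD\<close>). If \<open>G_{ij} \<ge> 0\<close>, then for given \<open>x\<close> the second sum is smallest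
  when \<open>\<bar>a $ i\<bar> = \<bar>b $ i\<bar>\<close> for all \<open>i\<close>, by the inequality between the arithmetic and geometric means,
  and its minimum is \<open>\<Sum> G_{ij} \<bar>x $ i\<bar> \<bar>x $ j\<bar>\<close>. Hence the form is nonnegative for all \<open>a\<close>, \<open>b\<close> exactly
  when \<open>h\<close> is Schur convex and the form in \<open>x\<close> with this minimum is nonnegative.
\<close>

section \<open>Matrix algebra\<close>

definition diag_mat :: "real^'n \<Rightarrow> real^'n^'n" where
  "diag_mat y = (\<chi> i j. if i = j then y $ i else 0)"

definition unit_mat :: "'n \<Rightarrow> 'n \<Rightarrow> real^'n^'n" where
  "unit_mat i j = axis i (axis j 1)"

lemma bounded_bilinear_matrix_mult:
  "bounded_bilinear ((**) :: real^'n^'m \<Rightarrow> real^'p^'n \<Rightarrow> real^'p^'m)"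
  unfolding bilinear_conv_bounded_bilinear[symmetric]
  by (auto simp: bilinear_def linear_iff matrix_matrix_mult_def vec_eq_iff sum.distrib
      sum_distrib_left algebra_simps)

lemmas matrix_mult_linear_simps =
  bounded_bilinear.add_left[OF bounded_bilinear_matrix_mult]
  bounded_bilinear.add_right[OF bounded_bilinear_matrix_mult]
  bounded_bilinear.diff_left[OF bounded_bilinear_matrix_mult]
  bounded_bilinear.diff_right[OF bounded_bilinear_matrix_mult]
  bounded_bilinear.minus_left[OF bounded_bilinear_matrix_mult]
  bounded_bilinear.minus_right[OF bounded_bilinear_matrix_mult]
  bounded_bilinear.scaleR_left[OF bounded_bilinear_matrix_mult]
  bounded_bilinear.scaleR_right[OF bounded_bilinear_matrix_mult]
  bounded_bilinear.zero_left[OF bounded_bilinear_matrix_mult]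
  bounded_bilinear.zero_right[OF bounded_bilinear_matrix_mult]

lemma linear_mult_left: "linear (\<lambda>Z::real^'n^'n. Q ** Z)"
  by (auto simp: linear_iff matrix_mult_linear_simps)

lemma linear_mult_right: "linear (\<lambda>Z::real^'n^'n. Z ** Q)"
  by (auto simp: linear_iff matrix_mult_linear_simps)

lemma diag_mat_nth [simp]: "diag_mat y $ i $ j = (if i = j then y $ i else 0)"
  by (simp add: diag_mat_def)

lemma unit_mat_nth: "unit_mat i j $ k $ l = (if k = i \<and> l = j then 1 else 0)"
  by (simp add: unit_mat_def axis_def)

lemma linear_diag_mat: "linear diag_mat"
  by (auto simp: linear_iff vec_eq_iff)

lemma det_diag_mat: "det (diag_mat y) = (\<Prod>i\<in>UNIV. y $ i)"
  by (subst det_diagonal) auto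

lemma diag_mat_mult: "diag_mat x ** diag_mat y = diag_mat (\<chi> i. x $ i * y $ i)"
  by (simp add: vec_eq_iff matrix_matrix_mult_def if_distrib[of "\<lambda>t. t * _"] cong: if_cong)

lemma diag_mat_mult_nth: "(diag_mat x ** M) $ i $ j = x $ i * M $ i $ j"
  by (simp add: matrix_matrix_mult_def if_distrib[of "\<lambda>t. t * _"] cong: if_cong)

lemma mult_diag_mat_nth: "(M ** diag_mat x) $ i $ j = M $ i $ j * x $ j"
  by (simp add: matrix_matrix_mult_def if_distrib cong: if_cong)

lemma transpose_diag_mat [simp]: "transpose (diag_mat y) = diag_mat y"
  by (simp add: vec_eq_iff transpose_def)

lemma GL_pos_diag_mat: "y \<in> pos_orthant \<Longrightarrow> diag_mat y \<in> GL_pos"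
  by (simp add: GL_pos_def pos_orthant_def det_diag_mat prod_pos)

lemma continuous_on_det: "continuous_on UNIV (det :: real^'n^'n \<Rightarrow> real)"
  unfolding det_def by (intro continuous_intros)

lemma open_GL_pos: "open (GL_pos :: (real^'n^'n) set)"
  unfolding GL_pos_def by (rule open_Collect_less[OF continuous_on_const continuous_on_det])

lemma open_pos_orthant: "open (pos_orthant :: (real^'n) set)"
proof -
  have "pos_orthant = (\<Inter>i\<in>UNIV. {y :: real^'n. 0 < y $ i})"
    by (auto simp: pos_orthant_def)
  also have "open \<dots>"
    by (intro open_INT) (auto intro!: open_Collect_less continuous_intros)
  finally show ?thesis .
qed

lemma rotation_mult_GL_pos:
  "rotation_matrix Q \<Longrightarrow> F \<in> GL_pos \<Longrightarrow> Q ** F \<in> GL_pos"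
  "rotation_matrix Q \<Longrightarrow> F \<in> GL_pos \<Longrightarrow> F ** Q \<in> GL_pos"
  by (auto simp: GL_pos_def det_mul rotation_matrix_def)

lemma rotation_matrix_mult:
  "rotation_matrix P \<Longrightarrow> rotation_matrix Q \<Longrightarrow> rotation_matrix (P ** Q)"
  for P :: "real^'n^'n"
  by (auto simp: rotation_matrix_def det_mul orthogonal_matrix_mul)

lemma rotation_matrix_transpose:
  "rotation_matrix Q \<Longrightarrow> rotation_matrix (transpose Q)" for Q :: "real^'n^'n"
  by (auto simp: rotation_matrix_def)

section \<open>Rotations in coordinate planes\<close>

definition plane_gen :: "'n \<Rightarrow> 'n \<Rightarrow> real^'n^'n" where
  "plane_gen i j = unit_mat i j - unit_mat j i"

text \<open>
  The rotation by the angle \<open>\<theta>\<close> in the plane of the coordinates \<open>i\<close> and \<open>j\<close>. With \<open>A\<close> the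
  generator and \<open>i \<noteq> j\<close>, \<open>A ** A ** A = - A\<close>, so this is the closed form of the exponential of \<open>\<theta> *\<^sub>R A\<close>.
  The generators span the skew matrices, which is why plane rotations suffice for first order
  consequences of rotation invariance.
\<close>

definition plane_rot :: "'n \<Rightarrow> 'n \<Rightarrow> real \<Rightarrow> real^'n^'n" where
  "plane_rot i j \<theta> =
     mat 1 + sin \<theta> *\<^sub>R plane_gen i j + (1 - cos \<theta>) *\<^sub>R (plane_gen i j ** plane_gen i j)"

lemma unit_mat_mult: "unit_mat i j ** unit_mat k l = (if j = k then unit_mat i l else 0)"
  by (auto simp: vec_eq_iff matrix_matrix_mult_def unit_mat_nth if_distrib[of "\<lambda>t. t * _"]
      sum.delta' cong: if_cong)

lemma transpose_unit_mat: "transpose (unit_mat i j) = unit_mat j i"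
  by (auto simp: vec_eq_iff transpose_def unit_mat_nth)

lemma transpose_linear_simps:
  "transpose (A + B) = transpose A + transpose B" "transpose (A - B) = transpose A - transpose B"
  "transpose (r *\<^sub>R A) = r *\<^sub>R transpose A" "transpose (- A) = - transpose A"
  for A :: "real^'n^'n"
  by (auto simp: vec_eq_iff transpose_def)

lemma plane_gen_cube:
  assumes "i \<noteq> j"
  shows "plane_gen i j ** plane_gen i j ** plane_gen i j = - plane_gen i j"
  using assms by (simp add: plane_gen_def matrix_mult_linear_simps unit_mat_mult)

lemma plane_rot_add:
  assumes "i \<noteq> j"
  shows "plane_rot i j \<alpha> ** plane_rot i j \<beta> = plane_rot i j (\<alpha> + \<beta>)"
proof -
  let ?A = "plane_gen i j"
  define B where "B = ?A ** ?A"
  have 1: "?A ** B = - ?A" "B ** ?A = - ?A" "B ** B = - B"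
    using plane_gen_cube[OF assms] by (simp_all add: B_def matrix_mul_assoc matrix_mult_linear_simps)
  show ?thesis
    unfolding plane_rot_def B_def[symmetric]
    by (simp add: matrix_mult_linear_simps 1 B_def[symmetric] sin_add cos_add scaleR_add_left
        scaleR_diff_left vec_eq_iff algebra_simps)
qed

lemma plane_rot_0 [simp]: "plane_rot i j 0 = mat 1"
  by (simp add: plane_rot_def)

lemma rotation_plane_rot:
  assumes "i \<noteq> j"
  shows "rotation_matrix (plane_rot i j \<theta>)"
proof -
  have tr: "transpose (plane_rot i j \<alpha>) = plane_rot i j (- \<alpha>)" for \<alpha>
  proof -
    have "transpose (plane_gen i j) = - plane_gen i j"
      by (simp add: plane_gen_def transpose_linear_simps transpose_unit_mat)
    then show ?thesis
      by (simp add: plane_rot_def transpose_linear_simps matrix_transpose_mul matrix_mult_linear_simps)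
  qed
  have orth: "orthogonal_matrix (plane_rot i j \<alpha>)" for \<alpha>
    by (simp add: orthogonal_matrix_def tr plane_rot_add[OF assms])
  \<comment> \<open>The determinant is \<open>1\<close> or \<open>- 1\<close>, and a rotation is the square of the rotation by half the angle.\<close>
  have "plane_rot i j \<theta> = plane_rot i j (\<theta> / 2) ** plane_rot i j (\<theta> / 2)"
    by (simp add: plane_rot_add[OF assms])
  then have "det (plane_rot i j \<theta>) = det (plane_rot i j (\<theta> / 2)) * det (plane_rot i j (\<theta> / 2))"
    by (simp add: det_mul)
  then have "det (plane_rot i j \<theta>) \<noteq> - 1"
    by (smt (verit) zero_le_square)
  with det_orthogonal_matrix[OF orth, of \<theta>] orth show ?thesis
    by (auto simp: rotation_matrix_def)
qed

lemma plane_rot_has_vector_derivative: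
  "(plane_rot i j has_vector_derivative plane_gen i j) (at 0)"
proof -
  have "((\<lambda>\<theta>. mat 1 + sin \<theta> *\<^sub>R plane_gen i j + (1 - cos \<theta>) *\<^sub>R (plane_gen i j ** plane_gen i j))
     has_vector_derivative plane_gen i j) (at 0)"
    by (auto intro!: derivative_eq_intros)
  then show ?thesis
    by (simp add: plane_rot_def[abs_def])
qed

lemma plane_rot_mult_has_vector_derivative:
  "((\<lambda>\<theta>. plane_rot i j \<theta> ** F) has_vector_derivative plane_gen i j ** F) (at 0)"
  "((\<lambda>\<theta>. F ** plane_rot i j \<theta>) has_vector_derivative F ** plane_gen i j) (at 0)"
  by (rule bounded_linear.has_vector_derivative[OF
        bounded_bilinear.bounded_linear_left[OF bounded_bilinear_matrix_mult]
        plane_rot_has_vector_derivative],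
      rule bounded_linear.has_vector_derivative[OF
        bounded_bilinear.bounded_linear_right[OF bounded_bilinear_matrix_mult]
        plane_rot_has_vector_derivative])

section \<open>Singular value decomposition by maximisation\<close>

text \<open>
  These are the weights in the maximisation below, where positivity makes their squares distinct as
  well, and later the direction in which a vector with repeated entries is perturbed.
\<close>

lemma exists_distinct_weights: "\<exists>c::real^'n. (\<forall>i. c $ i > 0) \<and> inj (\<lambda>i. c $ i)"
proof -
  obtain f :: "'n \<Rightarrow> nat" where "inj f"
    using finite_imp_inj_to_nat_seg[of "UNIV :: 'n set"] by auto
  then show ?thesis
    by (intro exI[of _ "\<chi> i. real (f i) + 1"]) (auto simp: inj_def)
qed

lemma compact_rotations: "compact {Q :: real^'n^'n. rotation_matrix Q}"
proof -
  have "bounded {Q :: real^'n^'n. rotation_matrix Q}"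
  proof (rule boundedI)
    fix Q :: "real^'n^'n" assume "Q \<in> {Q. rotation_matrix Q}"
    then have o: "orthogonal_matrix Q" by (simp add: rotation_matrix_def)
    have "norm Q \<le> (\<Sum>i\<in>UNIV. norm (Q $ i))"
      unfolding norm_vec_def by (rule L2_set_le_sum) auto
    also have "\<dots> = (\<Sum>i\<in>(UNIV::'n set). 1)"
    proof (rule sum.cong)
      fix i
      have "orthogonal_matrix (transpose Q)" using o by simp
      then show "norm (Q $ i) = 1"
        by (metis orthogonal_matrix_orthonormal_rows o row_def vec_lambda_eta)
    qed simp
    finally show "norm Q \<le> (\<Sum>i\<in>(UNIV::'n set). 1)" .
  qed
  moreover have "closed {Q :: real^'n^'n. rotation_matrix Q}"
  proof -
    have "{Q :: real^'n^'n. rotation_matrix Q} =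
       {Q. transpose Q ** Q = mat 1} \<inter> {Q. det Q = 1}"
      by (auto simp: rotation_matrix_def orthogonal_matrix)
    moreover have "continuous_on UNIV (\<lambda>Q :: real^'n^'n. transpose Q ** Q)"
      unfolding matrix_matrix_mult_def transpose_def by (intro continuous_intros)
    ultimately show ?thesis
      by (auto intro!: closed_Int closed_Collect_eq continuous_on_det)
  qed
  ultimately show ?thesis by (simp add: compact_eq_bounded_closed)
qed

lemma rotation_matrix_mat_1: "rotation_matrix (mat 1 :: real^'n^'n)"
  by (simp add: rotation_matrix_def orthogonal_matrix_def)

text \<open>
  Let \<open>U\<close> and \<open>V\<close> maximise the linear functional \<open>\<phi> Z = (\<Sum>k. c $ k * Z $ k $ k)\<close> of
  \<open>Z = U ** F ** V\<close> over pairs of rotations, with distinct positive weights \<open>c\<close>. Turning \<open>U\<close> and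
  \<open>V\<close> in the plane of \<open>i\<close> and \<open>j\<close> gives the two stationarity equations
  \<open>c $ i * Z $ j $ i = c $ j * Z $ i $ j\<close> and \<open>c $ j * Z $ j $ i = c $ i * Z $ i $ j\<close>, whose only
  solution is \<open>Z $ i $ j = Z $ j $ i = 0\<close>.
\<close>

lemma rotation_diagonalization:
  fixes F :: "real^'n^'n"
  shows "\<exists>U V z. rotation_matrix U \<and> rotation_matrix V \<and> U ** F ** V = diag_mat z"
proof -
  obtain c :: "real^'n" where c: "\<And>i. c $ i > 0" "inj (\<lambda>i. c $ i)"
    using exists_distinct_weights by blast
  define \<phi> :: "real^'n^'n \<Rightarrow> real" where "\<phi> Z = (\<Sum>k\<in>UNIV. c $ k * Z $ k $ k)" for Z
  let ?R = "{Q :: real^'n^'n. rotation_matrix Q}"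
  have "\<exists>p\<in>?R \<times> ?R. \<forall>q\<in>?R \<times> ?R. \<phi> (fst q ** F ** snd q) \<le> \<phi> (fst p ** F ** snd p)"
  proof (rule continuous_attains_sup)
    show "compact (?R \<times> ?R)" by (intro compact_Times compact_rotations)
    show "?R \<times> ?R \<noteq> {}" using rotation_matrix_mat_1 by auto
    show "continuous_on (?R \<times> ?R) (\<lambda>q. \<phi> (fst q ** F ** snd q))"
      unfolding \<phi>_def matrix_matrix_mult_def by (intro continuous_intros)
  qed
  then obtain U V where UV: "rotation_matrix U" "rotation_matrix V"
    and max: "\<And>P Q. rotation_matrix P \<Longrightarrow> rotation_matrix Q \<Longrightarrow> \<phi> (P ** F ** Q) \<le> \<phi> (U ** F ** V)"
    by auto
  define Z where "Z = U ** F ** V"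
  have lin: "linear \<phi>"
    by (auto simp: linear_iff \<phi>_def sum.distrib sum_distrib_left algebra_simps)
  have crit: "\<phi> M = 0" if d: "(r has_vector_derivative M) (at 0)" and le: "\<And>\<theta>. \<phi> (r \<theta>) \<le> \<phi> (r (0::real))" for r M
  proof -
    have "((\<lambda>\<theta>. \<phi> (r \<theta>)) has_vector_derivative \<phi> M) (at 0)"
      by (rule bounded_linear.has_vector_derivative[OF linear_conv_bounded_linear[THEN iffD1, OF lin] d])
    then have "((\<lambda>\<theta>. \<phi> (r \<theta>)) has_real_derivative \<phi> M) (at 0)"
      by (simp add: has_real_derivative_iff_has_vector_derivative)
    then show ?thesis
      by (rule DERIV_local_max[where d = 1]) (auto simp: le)
  qed
  have "Z $ i $ j = 0" if ij: "i \<noteq> j" for i j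
  proof -
    have rot: "rotation_matrix (plane_rot i j \<theta>)" for \<theta>
      by (rule rotation_plane_rot[OF ij])
    have "\<phi> (plane_gen i j ** Z) = 0"
    proof (rule crit[OF plane_rot_mult_has_vector_derivative(1)])
      show "\<phi> (plane_rot i j \<theta> ** Z) \<le> \<phi> (plane_rot i j 0 ** Z)" for \<theta>
        using max[OF rotation_matrix_mult[OF rot UV(1)] UV(2), of \<theta>]
        by (simp add: Z_def matrix_mul_assoc)
    qed
    moreover have "\<phi> (Z ** plane_gen i j) = 0"
    proof (rule crit[OF plane_rot_mult_has_vector_derivative(2)])
      show "\<phi> (Z ** plane_rot i j \<theta>) \<le> \<phi> (Z ** plane_rot i j 0)" for \<theta>
        using max[OF UV(1) rotation_matrix_mult[OF UV(2) rot], of \<theta>]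
        by (simp add: Z_def matrix_mul_assoc)
    qed
    moreover have "\<phi> (unit_mat k l ** Z) = c $ k * Z $ l $ k"
       "\<phi> (Z ** unit_mat k l) = c $ l * Z $ l $ k" for k l
    proof -
      have "(unit_mat k l ** Z) $ m $ m = (if m = k then Z $ l $ k else 0)"
        "(Z ** unit_mat k l) $ m $ m = (if m = l then Z $ l $ k else 0)" for m
        by (auto simp: matrix_matrix_mult_def unit_mat_nth if_distrib[of "\<lambda>t. t * _"] if_distrib[of "\<lambda>t. _ * t"]
            cong: if_cong)
      then show "\<phi> (unit_mat k l ** Z) = c $ k * Z $ l $ k"
       "\<phi> (Z ** unit_mat k l) = c $ l * Z $ l $ k"
        by (simp_all add: \<phi>_def if_distrib[of "\<lambda>t. _ * t"] cong: if_cong)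
    qed
    ultimately have eqs: "c $ i * Z $ j $ i = c $ j * Z $ i $ j" "c $ j * Z $ j $ i = c $ i * Z $ i $ j"
      by (simp_all add: plane_gen_def matrix_mult_linear_simps linear_diff[OF lin])
    have "(c $ i)\<^sup>2 * Z $ i $ j = c $ i * (c $ j * Z $ j $ i)"
      by (simp add: eqs(2) power2_eq_square)
    also have "\<dots> = (c $ j)\<^sup>2 * Z $ i $ j"
      using eqs(1) by (simp add: power2_eq_square mult.left_commute)
    finally have "((c $ i)\<^sup>2 - (c $ j)\<^sup>2) * Z $ i $ j = 0"
      by (simp add: left_diff_distrib)
    moreover have "c $ i \<noteq> c $ j"
      using c(2) ij by (auto dest: injD)
    then have "(c $ i)\<^sup>2 \<noteq> (c $ j)\<^sup>2"
      using c(1)[of i] c(1)[of j] by (simp add: power2_eq_iff_nonneg)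
    ultimately show ?thesis by simp
  qed
  then have "Z = diag_mat (\<chi> i. Z $ i $ i)"
    by (auto simp: vec_eq_iff)
  with UV show ?thesis
    unfolding Z_def by blast
qed

lemma sgn_prod_real: "sgn (\<Prod>i\<in>A. f i) = (\<Prod>i\<in>A. sgn (f i :: real))"
  by (induction A rule: infinite_finite_induct) (auto simp: sgn_mult)

text \<open>
  The diagonal matrix obtained from \<open>F\<close> has positive determinant, hence an even number of negative
  entries; the diagonal matrix \<open>J\<close> of the signs is therefore itself a rotation and can be absorbed.
\<close>

lemma singular_value_decomposition:
  assumes "F \<in> GL_pos"
  obtains P Q y where "rotation_matrix P" "rotation_matrix Q" "y \<in> pos_orthant"
    "F = P ** diag_mat y ** Q"
proof -
  obtain U V z where UV: "rotation_matrix U" "rotation_matrix V" and z: "U ** F ** V = diag_mat z"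
    using rotation_diagonalization by blast
  have "U ** F ** V \<in> GL_pos"
    using UV assms by (simp add: rotation_mult_GL_pos)
  then have pos: "(\<Prod>i\<in>UNIV. z $ i) > 0"
    by (simp add: z GL_pos_def det_diag_mat)
  define y :: "real^'a" where "y = (\<chi> i. \<bar>z $ i\<bar>)"
  define J :: "real^'a^'a" where "J = diag_mat (\<chi> i. sgn (z $ i))"
  have nz: "z $ i \<noteq> 0" for i using pos by (metis UNIV_I finite less_irrefl prod_zero)
  have JJ: "J ** J = mat 1"
    using nz by (auto simp: J_def diag_mat_mult vec_eq_iff mat_def sgn_if)
  have "det J = sgn (\<Prod>i\<in>UNIV. z $ i)"
    by (simp add: J_def det_diag_mat sgn_prod_real)
  then have J: "rotation_matrix J"
    using pos JJ by (simp add: rotation_matrix_def orthogonal_matrix J_def)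
  have zJ: "diag_mat z = J ** diag_mat y"
    by (simp add: J_def y_def diag_mat_mult vec_eq_iff sgn_mult_abs)
  have "F = transpose U ** (U ** F ** V) ** transpose V"
    using UV by (simp add: rotation_matrix_def orthogonal_matrix_def matrix_mul_assoc)
       (simp add: matrix_mul_assoc[symmetric])
  also have "\<dots> = (transpose U ** J) ** diag_mat y ** transpose V"
    by (simp add: z zJ matrix_mul_assoc)
  finally show ?thesis
    using UV J nz by (intro that[of "transpose U ** J" "transpose V" y])
      (auto intro!: rotation_matrix_mult rotation_matrix_transpose simp: pos_orthant_def y_def)
qed

section \<open>Singular values of diagonal matrices\<close>

text \<open>
  Uniqueness of the square root: if \<open>P ** P = D ** D\<close> with \<open>D\<close> the given diagonal matrix, then \<open>P\<close>
  commutes with \<open>D ** D\<close>, hence with \<open>D\<close> because the entries of \<open>D\<close> are positive. So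
  \<open>(P + D) ** (P - D) = 0\<close>, and \<open>P + D\<close> is positive definite.
\<close>

lemma psd_sqrt_diag_mat:
  fixes y :: "real^'n"
  assumes y: "y \<in> pos_orthant"
  shows "psd_sqrt (diag_mat y ** diag_mat y) = diag_mat y"
  unfolding psd_sqrt_def
proof (rule the_equality)
  let ?D = "diag_mat y"
  have ypos: "y $ i > 0" for i using y by (simp add: pos_orthant_def)
  have Dx: "x \<bullet> (?D *v x) = (\<Sum>i\<in>UNIV. y $ i * (x $ i)\<^sup>2)" for x
    by (simp add: inner_vec_def matrix_vector_mult_def if_distrib[of "\<lambda>t. t * _"] power2_eq_square
        mult.left_commute cong: if_cong)
  have "x \<bullet> (?D *v x) \<ge> 0" for x
    unfolding Dx by (intro sum_nonneg mult_nonneg_nonneg less_imp_le[OF ypos]) auto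
  then show "psd_matrix ?D \<and> ?D ** ?D = ?D ** ?D"
    by (simp add: psd_matrix_def)
  fix P :: "real^'n^'n"
  assume "psd_matrix P \<and> P ** P = ?D ** ?D"
  then have P: "x \<bullet> (P *v x) \<ge> 0" and PP: "P ** P = ?D ** ?D" for x
    by (auto simp: psd_matrix_def)
  have "P ** (?D ** ?D) = (?D ** ?D) ** P"
    by (metis PP matrix_mul_assoc)
  then have "P $ i $ j * (y $ j * y $ j) = (y $ i * y $ i) * P $ i $ j" for i j
    by (simp add: vec_eq_iff diag_mat_mult mult_diag_mat_nth diag_mat_mult_nth)
  then have "P $ i $ j * y $ j = y $ i * P $ i $ j" for i j
    using ypos[of i] ypos[of j] by (smt (verit) mult.commute mult_cancel_right mult_less_cancel_right mult_strict_mono)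
  then have comm: "P ** ?D = ?D ** P"
    by (simp add: vec_eq_iff mult_diag_mat_nth diag_mat_mult_nth)
  have zero: "(P + ?D) ** (P - ?D) = 0"
    by (simp add: matrix_mult_linear_simps PP comm)
  have "(P - ?D) *v x = 0" for x
  proof (rule ccontr)
    define u where "u = (P - ?D) *v x"
    assume "(P - ?D) *v x \<noteq> 0"
    then have "u \<noteq> 0" by (simp add: u_def)
    then obtain k where "u $ k \<noteq> 0" by (auto simp: vec_eq_iff)
    then have "0 < (\<Sum>i\<in>UNIV. y $ i * (u $ i)\<^sup>2)"
      using ypos by (intro sum_pos2[of _ k]) (simp_all add: less_imp_le)
    then have "0 < u \<bullet> ((P + ?D) *v u)"
      using P[of u] by (simp add: matrix_vector_mult_add_rdistrib inner_add_right Dx)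
    moreover have "(P + ?D) *v u = 0"
      by (simp add: u_def matrix_vector_mul_assoc zero)
    ultimately show False by simp
  qed
  then have "P - ?D = 0"
    by (simp add: matrix_eq)
  then show "P = ?D" by simp
qed

text \<open>
  Both products are split polynomials, so their roots agree as multisets.
\<close>

lemma equal_linear_products_imp_perm:
  fixes s y :: "real^'n"
  assumes "\<And>t. (\<Prod>i\<in>UNIV. t - s $ i) = (\<Prod>i\<in>UNIV. t - y $ i)"
  shows "\<exists>p. bij p \<and> s = (\<chi> i. y $ p i)"
proof -
  define r where "r z = (\<Prod>i\<in>(UNIV::'n set). [:- (z $ i), 1:])" for z :: "real^'n"
  have "proots (r z) = image_mset (\<lambda>i. z $ i) (mset_set UNIV)" for z
    by (simp add: r_def proots_prod flip: sum_unfold_sum_mset)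
       (simp add: sum_unfold_sum_mset)
  moreover have "r s = r y"
    using assms by (intro poly_eq_poly_eq_iff[THEN iffD1] ext) (simp add: r_def poly_prod)
  ultimately have "image_mset (\<lambda>i. s $ i) (mset_set UNIV) = image_mset (\<lambda>i. y $ i) (mset_set UNIV)"
    by metis
  then obtain p where "p permutes UNIV" "\<forall>i. s $ i = y $ p i"
    by (elim image_mset_eq_implies_permutes[rotated]) auto
  then show ?thesis
    by (intro exI[of _ p]) (auto simp: vec_eq_iff permutes_bij)
qed

lemma singular_values_diag_mat:
  assumes y: "y \<in> pos_orthant"
  shows "\<exists>p. bij p \<and> singular_values (diag_mat y) = (\<chi> i. y $ p i)"
proof -
  have eig: "eigenvalue_vector (diag_mat y) s \<longleftrightarrow> (\<forall>t. (\<Prod>i\<in>UNIV. t - y $ i) = (\<Prod>i\<in>UNIV. t - s $ i))" for s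
  proof -
    have "mat t - diag_mat y = diag_mat (\<chi> i. t - y $ i)" for t
      by (simp add: vec_eq_iff mat_def)
    then show ?thesis by (simp add: eigenvalue_vector_def det_diag_mat)
  qed
  have "singular_values (diag_mat y) = (SOME s. eigenvalue_vector (diag_mat y) s)"
    by (simp add: singular_values_def psd_sqrt_diag_mat[OF y])
  then have "eigenvalue_vector (diag_mat y) (singular_values (diag_mat y))"
    using eig by (metis someI)
  then show ?thesis
    unfolding eig by (intro equal_linear_products_imp_perm) simp
qed

section \<open>Directional derivatives\<close>

lemma line_has_vector_derivative: "((\<lambda>t. x + t *\<^sub>R u) has_vector_derivative u) (at s)"
  by (auto intro!: derivative_eq_intros)

lemma has_vector_derivative_compose:
  assumes "(f has_derivative F) (at (c t))" "(c has_vector_derivative u) (at t)"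
  shows "((\<lambda>s. f (c s)) has_vector_derivative F u) (at t)"
proof -
  interpret F: bounded_linear F using assms(1) by (rule has_derivative_bounded_linear)
  have "((\<lambda>s. f (c s)) has_derivative (\<lambda>s. F (s *\<^sub>R u))) (at t)"
    using has_derivative_compose[OF assms(2)[unfolded has_vector_derivative_def] assms(1)] .
  then show ?thesis by (simp add: has_vector_derivative_def F.scaleR)
qed

lemma dir_deriv_eq:
  assumes "(f has_derivative F) (at x)"
  shows "dir_deriv u f x = F u"
proof -
  have "((\<lambda>t. f (x + t *\<^sub>R u)) has_vector_derivative F u) (at 0)"
    by (rule has_vector_derivative_compose[where c = "\<lambda>t. x + t *\<^sub>R u"])
       (use assms line_has_vector_derivative in auto)
  then show ?thesis
    unfolding dir_deriv_def
    by (intro DERIV_imp_deriv) (simp add: has_real_derivative_iff_has_vector_derivative)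
qed

lemma eventually_line_in:
  fixes x u :: "'a::real_normed_vector"
  assumes "open S" "x \<in> S"
  shows "\<forall>\<^sub>F t in nhds (0::real). x + t *\<^sub>R u \<in> S"
proof -
  have "isCont (\<lambda>t. x + t *\<^sub>R u) 0"
    by (intro continuous_intros)
  then have "((\<lambda>t. x + t *\<^sub>R u) \<longlongrightarrow> x + 0 *\<^sub>R u) (nhds 0)"
    using tendsto_at_iff_tendsto_nhds[of "\<lambda>t. x + t *\<^sub>R u" 0] by (simp add: isCont_def)
  then show ?thesis
    using topological_tendstoD[OF _ assms(1)] assms(2) by simp
qed

text \<open>
  Every invariance used below (left and right rotations, permutations of coordinates, restriction to
  diagonal matrices) has the form \<open>f (L z) = k z\<close> with \<open>L\<close> linear; this lemma and the next transport
  directional derivatives along such an identity.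
\<close>

lemma dir_deriv_linear_comp:
  assumes L: "linear L" and T: "open T" "x \<in> T" and eq: "\<And>z. z \<in> T \<Longrightarrow> f (L z) = k z"
  shows "dir_deriv (L u) f (L x) = dir_deriv u k x"
  unfolding dir_deriv_def
proof (rule deriv_cong_ev)
  show "\<forall>\<^sub>F t in nhds 0. f (L x + t *\<^sub>R L u) = k (x + t *\<^sub>R u)"
    using eventually_line_in[OF T, of u]
    by eventually_elim (simp add: eq[symmetric] linear_add[OF L] linear_scale[OF L])
qed simp

lemma dir_deriv2_linear_comp:
  assumes L: "linear L" and T: "open T" "x \<in> T" and eq: "\<And>z. z \<in> T \<Longrightarrow> f (L z) = k z"
  shows "dir_deriv (L v) (dir_deriv (L u) f) (L x) = dir_deriv v (dir_deriv u k) x"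
proof (rule dir_deriv_linear_comp[OF L T])
  show "dir_deriv (L u) f (L z) = dir_deriv u k z" if "z \<in> T" for z
    using dir_deriv_linear_comp[where f = f and k = k, OF L T(1) that eq] by simp
qed

lemma dir_deriv2_eq:
  fixes f' :: "'a::real_normed_vector \<Rightarrow> 'a \<Rightarrow>\<^sub>L real"
  assumes S: "open S" "x \<in> S"
    and f': "\<And>z. z \<in> S \<Longrightarrow> (f has_derivative blinfun_apply (f' z)) (at z)"
    and f'': "(f' has_derivative f'') (at x)"
  shows "dir_deriv v (dir_deriv u f) x = f'' v u"
proof -
  have "dir_deriv v (dir_deriv u f) x = dir_deriv v (\<lambda>z. f' z u) x"
    using dir_deriv_linear_comp[of "\<lambda>z. z" S x "dir_deriv u f" "\<lambda>z. f' z u" v] S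
    by (simp add: dir_deriv_eq[OF f'] linear_ident)
  also have "((\<lambda>z. f' z u) has_derivative (\<lambda>v. f'' v u)) (at x)"
    by (rule bounded_linear.has_derivative[OF
         bounded_bilinear.bounded_linear_left[OF bounded_bilinear_blinfun_apply] f''])
  then have "dir_deriv v (\<lambda>z. f' z u) x = f'' v u"
    by (rule dir_deriv_eq)
  finally show ?thesis .
qed

section \<open>Infinitesimal form of objectivity and isotropy\<close>

lemma unit_mat_expansion:
  "M = (\<Sum>i\<in>UNIV. \<Sum>j\<in>UNIV. M $ i $ j *\<^sub>R unit_mat i j)"
proof -
  have "(\<Sum>j\<in>UNIV. M $ i $ j * unit_mat i j $ a $ b) = (if a = i then M $ i $ b else 0)" for i a b
    by (simp add: unit_mat_nth if_distrib[of "\<lambda>t. _ * t"] cong: if_cong)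
  then show ?thesis by (simp add: vec_eq_iff)
qed

text \<open>
  The sum of \<open>(K $ i $ j / 2) *\<^sub>R plane_gen i j\<close> over all \<open>i\<close>, \<open>j\<close> is \<open>K\<close>, so the generators of the plane
  rotations span the skew matrices.
\<close>

lemma linear_zero_on_skew:
  fixes \<phi> :: "real^'n^'n \<Rightarrow> real"
  assumes lin: "linear \<phi>" and zero: "\<And>i j. i \<noteq> j \<Longrightarrow> \<phi> (plane_gen i j) = 0"
    and skew: "transpose K = - K"
  shows "\<phi> K = 0"
proof -
  have sk: "K $ b $ a = - K $ a $ b" for a b
    using arg_cong[OF skew, of "\<lambda>M. M $ a $ b"] by (simp add: transpose_def)
  have "(\<Sum>i\<in>UNIV. \<Sum>j\<in>UNIV. (K $ i $ j / 2) *\<^sub>R plane_gen i j) =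
      (1 / 2) *\<^sub>R (\<Sum>i\<in>UNIV. \<Sum>j\<in>UNIV. K $ i $ j *\<^sub>R unit_mat i j) -
      (1 / 2) *\<^sub>R (\<Sum>i\<in>UNIV. \<Sum>j\<in>UNIV. K $ i $ j *\<^sub>R unit_mat j i)"
    by (simp add: plane_gen_def scaleR_diff_right sum_subtractf scaleR_sum_right)
  also have "(\<Sum>i\<in>UNIV. \<Sum>j\<in>UNIV. K $ i $ j *\<^sub>R unit_mat j i) = - K"
  proof -
    have "(\<Sum>i\<in>UNIV. \<Sum>j\<in>UNIV. K $ i $ j *\<^sub>R unit_mat j i) =
        (\<Sum>j\<in>UNIV. \<Sum>i\<in>UNIV. transpose K $ j $ i *\<^sub>R unit_mat j i)"
      by (subst sum.swap) (simp add: transpose_def)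
    also have "\<dots> = - K"
      unfolding unit_mat_expansion[symmetric] skew ..
    finally show ?thesis .
  qed
  finally have "\<phi> K = \<phi> (\<Sum>i\<in>UNIV. \<Sum>j\<in>UNIV. (K $ i $ j / 2) *\<^sub>R plane_gen i j)"
    by (simp add: unit_mat_expansion[symmetric] scaleR_half_double)
  also have "\<dots> = (\<Sum>i\<in>UNIV. \<Sum>j\<in>UNIV. (K $ i $ j / 2) * \<phi> (plane_gen i j))"
    by (simp add: linear_sum[OF lin] linear_scale[OF lin])
  also have "\<dots> = 0"
  proof (intro sum.neutral ballI)
    fix i j show "K $ i $ j / 2 * \<phi> (plane_gen i j) = 0"
      using zero[of i j] sk[of i i] by (cases "i = j") auto
  qed
  finally show ?thesis .
qed

text \<open>
  The derivatives of \<open>w\<close> and \<open>g\<close> are parameters, so that they can be named in the statements. The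
  assumption \<open>w_diag\<close> is all that is kept of the relation between \<open>w\<close> and the singular values.
\<close>

locale isotropic_function =
  fixes w :: "real^'n^'n \<Rightarrow> real"
    and w' :: "real^'n^'n \<Rightarrow> (real^'n^'n) \<Rightarrow>\<^sub>L real"
    and w'' :: "real^'n^'n \<Rightarrow> (real^'n^'n) \<Rightarrow>\<^sub>L (real^'n^'n) \<Rightarrow>\<^sub>L real"
    and g :: "real^'n \<Rightarrow> real"
    and g' :: "real^'n \<Rightarrow> (real^'n) \<Rightarrow>\<^sub>L real"
    and g'' :: "real^'n \<Rightarrow> (real^'n) \<Rightarrow>\<^sub>L (real^'n) \<Rightarrow>\<^sub>L real"
  assumes obj: "objective w" and iso: "isotropic w"
    and w': "F \<in> GL_pos \<Longrightarrow> (w has_derivative blinfun_apply (w' F)) (at F)"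
    and w'': "F \<in> GL_pos \<Longrightarrow> (w' has_derivative blinfun_apply (w'' F)) (at F)"
    and w''_continuous: "continuous_on GL_pos w''"
    and g': "y \<in> pos_orthant \<Longrightarrow> (g has_derivative blinfun_apply (g' y)) (at y)"
    and g'': "y \<in> pos_orthant \<Longrightarrow> (g' has_derivative blinfun_apply (g'' y)) (at y)"
    and g''_continuous: "continuous_on pos_orthant g''"
    and g_sym: "symmetric_on_pos g"
    and w_diag: "y \<in> pos_orthant \<Longrightarrow> w (diag_mat y) = g y"
begin

lemma w'_eq: "F \<in> GL_pos \<Longrightarrow> dir_deriv Z w F = w' F Z"
  by (rule dir_deriv_eq[OF w'])

lemma w''_eq: "F \<in> GL_pos \<Longrightarrow> dir_deriv Z (dir_deriv Y w) F = w'' F Z Y"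
  by (rule dir_deriv2_eq[OF open_GL_pos _ w' w''])

lemma g'_eq: "y \<in> pos_orthant \<Longrightarrow> dir_deriv z g y = g' y z"
  by (rule dir_deriv_eq[OF g'])

lemma g''_eq: "y \<in> pos_orthant \<Longrightarrow> dir_deriv z (dir_deriv u g) y = g'' y z u"
  by (rule dir_deriv2_eq[OF open_pos_orthant _ g' g''])

lemma w'_rotate_left:
  assumes "rotation_matrix Q" "F \<in> GL_pos"
  shows "w' (Q ** F) (Q ** Z) = w' F Z"
  using dir_deriv_linear_comp[OF linear_mult_left open_GL_pos assms(2), of w Q w Z] assms obj
  by (simp add: w'_eq rotation_mult_GL_pos objective_def)

lemma w'_rotate_right:
  assumes "rotation_matrix Q" "F \<in> GL_pos"
  shows "w' (F ** Q) (Z ** Q) = w' F Z"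
  using dir_deriv_linear_comp[OF linear_mult_right open_GL_pos assms(2), of w Q w Z] assms iso
  by (simp add: w'_eq rotation_mult_GL_pos isotropic_def)

lemma w''_rotate:
  assumes "rotation_matrix P" "rotation_matrix Q" "F \<in> GL_pos"
  shows "w'' (P ** F ** Q) (P ** Z ** Q) (P ** Y ** Q) = w'' F Z Y"
proof -
  have "linear (\<lambda>Z::real^'n^'n. P ** Z ** Q)"
    by (auto simp: linear_iff matrix_mult_linear_simps)
  from dir_deriv2_linear_comp[OF this open_GL_pos assms(3), of w w Z Y] assms obj iso show ?thesis
    by (simp add: w''_eq rotation_mult_GL_pos isotropic_def objective_def)
qed

lemma w'_diag: "y \<in> pos_orthant \<Longrightarrow> w' (diag_mat y) (diag_mat x) = g' y x"
  using dir_deriv_linear_comp[OF linear_diag_mat open_pos_orthant, of y w g x]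
  by (simp add: w'_eq g'_eq GL_pos_diag_mat w_diag)

lemma w''_diag: "y \<in> pos_orthant \<Longrightarrow> w'' (diag_mat y) (diag_mat x) (diag_mat z) = g'' y x z"
  using dir_deriv2_linear_comp[OF linear_diag_mat open_pos_orthant, of y w g x z]
  by (simp add: w''_eq g''_eq GL_pos_diag_mat w_diag)

lemma w'_vanishes_along_constant:
  assumes "c 0 = F" "F \<in> GL_pos" "(c has_vector_derivative Z) (at (0::real))" "\<And>s. w (c s) = w F"
  shows "w' F Z = 0"
proof -
  have "((\<lambda>s. w (c s)) has_vector_derivative w' F Z) (at 0)"
    by (rule has_vector_derivative_compose[where f = w and c = c]) (use assms in \<open>simp_all add: w'\<close>)
  then show ?thesis
    unfolding assms(4) by (rule vector_derivative_unique_at[OF _ has_vector_derivative_const])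
qed

lemma w'_has_derivative_mult:
  assumes F: "F \<in> GL_pos" and c: "(c has_vector_derivative Z) (at (0::real))" "c 0 = F"
    and e: "(e has_vector_derivative Y) (at 0)"
  shows "((\<lambda>s. w' (c s) (e s)) has_vector_derivative w'' F Z (e 0) + w' F Y) (at 0)"
proof -
  have "((\<lambda>s. w' (c s)) has_vector_derivative w'' F Z) (at 0)"
    by (rule has_vector_derivative_compose[where f = w' and c = c]) (use F c in \<open>simp_all add: w''\<close>)
  from bounded_bilinear.has_vector_derivative[OF bounded_bilinear_blinfun_apply this e] c(2)
  show ?thesis by (simp add: add.commute)
qed

text \<open>
  For rotations \<open>R \<theta>\<close> in a coordinate plane, differentiating \<open>w (R \<theta> ** F) = w F\<close> at \<open>\<theta> = 0\<close>
  gives the first identity for the generator of the rotation. The second comes from differentiating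
  \<open>w' (R \<theta> ** F) (R \<theta> ** Z) = w' F Z\<close> in \<open>\<theta>\<close>, the third from differentiating the first in \<open>F\<close>
  in the direction \<open>Z\<close>; linearity extends them from generators to skew \<open>K\<close>. The second and the third
  allow a tangent direction \<open>K ** F\<close> of the orbit in either argument of the second derivative.
\<close>

lemma infinitesimal_objectivity:
  assumes F: "F \<in> GL_pos" and K: "transpose K = - K"
  shows "w' F (K ** F) = 0"
    and "w'' F (K ** F) Z + w' F (K ** Z) = 0"
    and "w'' F Z (K ** F) + w' F (K ** Z) = 0"
proof -
  have gen: "w' E (plane_gen i j ** E) = 0" if "i \<noteq> j" "E \<in> GL_pos" for i j E
    by (rule w'_vanishes_along_constant[OF _ _ plane_rot_mult_has_vector_derivative(1)[of i j E]])
       (use that obj rotation_plane_rot[of i j] in \<open>auto simp: objective_def\<close>)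
  have first: "w' E (K ** E) = 0" if "E \<in> GL_pos" for E
    by (rule linear_zero_on_skew[where \<phi> = "\<lambda>K. w' E (K ** E)", OF _ gen[OF _ that] K])
       (auto simp: linear_iff matrix_mult_linear_simps blinfun.bilinear_simps)
  show "w' F (K ** F) = 0" by (rule first[OF F])
  have gen2: "w'' F (plane_gen i j ** F) Z + w' F (plane_gen i j ** Z) = 0" if "i \<noteq> j" for i j
  proof -
    have "((\<lambda>s. w' (plane_rot i j s ** F) (plane_rot i j s ** Z)) has_vector_derivative
        w'' F (plane_gen i j ** F) Z + w' F (plane_gen i j ** Z)) (at 0)"
      using w'_has_derivative_mult[OF F plane_rot_mult_has_vector_derivative(1)[of i j F] _
          plane_rot_mult_has_vector_derivative(1)[of i j Z]] by simp
    then have "((\<lambda>s. w' F Z) has_vector_derivative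
        w'' F (plane_gen i j ** F) Z + w' F (plane_gen i j ** Z)) (at 0)"
      by (simp add: w'_rotate_left[OF rotation_plane_rot[OF that] F])
    then show ?thesis
      using vector_derivative_unique_at[OF _ has_vector_derivative_const] by blast
  qed
  show "w'' F (K ** F) Z + w' F (K ** Z) = 0"
    by (rule linear_zero_on_skew[where \<phi> = "\<lambda>K. w'' F (K ** F) Z + w' F (K ** Z)", OF _ gen2 K])
       (auto simp: linear_iff matrix_mult_linear_simps blinfun.bilinear_simps algebra_simps)
  have "((\<lambda>s. w' (F + s *\<^sub>R Z) (K ** (F + s *\<^sub>R Z))) has_vector_derivative
      w'' F Z (K ** F) + w' F (K ** Z)) (at 0)"
    using w'_has_derivative_mult[OF F line_has_vector_derivative[of F Z] _
       bounded_linear.has_vector_derivative[OF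
        bounded_bilinear.bounded_linear_right[OF bounded_bilinear_matrix_mult, of K]
        line_has_vector_derivative[of F Z]]] by simp
  moreover have "\<forall>\<^sub>F s in nhds 0. w' (F + s *\<^sub>R Z) (K ** (F + s *\<^sub>R Z)) = 0"
    using eventually_line_in[OF open_GL_pos F, of Z] by eventually_elim (rule first)
  ultimately have "((\<lambda>s. 0) has_real_derivative w'' F Z (K ** F) + w' F (K ** Z)) (at 0)"
    by (subst (asm) has_real_derivative_iff_has_vector_derivative[symmetric], subst (asm) DERIV_cong_ev)
       (auto intro: refl)
  then show "w'' F Z (K ** F) + w' F (K ** Z) = 0"
    using DERIV_unique[OF _ DERIV_const] by blast
qed

text \<open>
  The same three identities for multiplication from the right.
\<close>

lemma infinitesimal_isotropy:
  assumes F: "F \<in> GL_pos" and K: "transpose K = - K"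
  shows "w' F (F ** K) = 0"
    and "w'' F (F ** K) Z + w' F (Z ** K) = 0"
    and "w'' F Z (F ** K) + w' F (Z ** K) = 0"
proof -
  have gen: "w' E (E ** plane_gen i j) = 0" if "i \<noteq> j" "E \<in> GL_pos" for i j E
    by (rule w'_vanishes_along_constant[OF _ _ plane_rot_mult_has_vector_derivative(2)[of E i j]])
       (use that iso rotation_plane_rot[of i j] in \<open>auto simp: isotropic_def\<close>)
  have first: "w' E (E ** K) = 0" if "E \<in> GL_pos" for E
    by (rule linear_zero_on_skew[where \<phi> = "\<lambda>K. w' E (E ** K)", OF _ gen[OF _ that] K])
       (auto simp: linear_iff matrix_mult_linear_simps blinfun.bilinear_simps)
  show "w' F (F ** K) = 0" by (rule first[OF F])
  have gen2: "w'' F (F ** plane_gen i j) Z + w' F (Z ** plane_gen i j) = 0" if "i \<noteq> j" for i j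
  proof -
    have "((\<lambda>s. w' (F ** plane_rot i j s) (Z ** plane_rot i j s)) has_vector_derivative
        w'' F (F ** plane_gen i j) Z + w' F (Z ** plane_gen i j)) (at 0)"
      using w'_has_derivative_mult[OF F plane_rot_mult_has_vector_derivative(2)[of F i j] _
          plane_rot_mult_has_vector_derivative(2)[of Z i j]] by simp
    then have "((\<lambda>s. w' F Z) has_vector_derivative
        w'' F (F ** plane_gen i j) Z + w' F (Z ** plane_gen i j)) (at 0)"
      by (simp add: w'_rotate_right[OF rotation_plane_rot[OF that] F])
    then show ?thesis
      using vector_derivative_unique_at[OF _ has_vector_derivative_const] by blast
  qed
  show "w'' F (F ** K) Z + w' F (Z ** K) = 0"
    by (rule linear_zero_on_skew[where \<phi> = "\<lambda>K. w'' F (F ** K) Z + w' F (Z ** K)", OF _ gen2 K])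
       (auto simp: linear_iff matrix_mult_linear_simps blinfun.bilinear_simps algebra_simps)
  have "((\<lambda>s. w' (F + s *\<^sub>R Z) ((F + s *\<^sub>R Z) ** K)) has_vector_derivative
      w'' F Z (F ** K) + w' F (Z ** K)) (at 0)"
    using w'_has_derivative_mult[OF F line_has_vector_derivative[of F Z] _
       bounded_linear.has_vector_derivative[OF
        bounded_bilinear.bounded_linear_left[OF bounded_bilinear_matrix_mult, of K]
        line_has_vector_derivative[of F Z]]] by simp
  moreover have "\<forall>\<^sub>F s in nhds 0. w' (F + s *\<^sub>R Z) ((F + s *\<^sub>R Z) ** K) = 0"
    using eventually_line_in[OF open_GL_pos F, of Z] by eventually_elim (rule first)
  ultimately have "((\<lambda>s. 0) has_real_derivative w'' F Z (F ** K) + w' F (Z ** K)) (at 0)"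
    by (subst (asm) has_real_derivative_iff_has_vector_derivative[symmetric], subst (asm) DERIV_cong_ev)
       (auto intro: refl)
  then show "w'' F Z (F ** K) + w' F (Z ** K) = 0"
    using DERIV_unique[OF _ DERIV_const] by blast
qed

end

section \<open>Second derivative at diagonal matrices with distinct entries\<close>

lemma axis_expansion: "x = (\<Sum>i\<in>UNIV. x $ i *\<^sub>R axis i 1)" for x :: "real^'n"
  by (simp add: vec_eq_iff axis_def if_distrib[of "\<lambda>t. _ * t"] cong: if_cong)

text \<open>
  For distinct positive \<open>y\<close> every direction is the sum of a diagonal one and of tangent directions
  of the two rotation actions at \<open>diag_mat y\<close>. The entries of \<open>A\<close> and \<open>C\<close> solve the equations
  \<open>A $ i $ k * y $ k + y $ i * C $ i $ k = M $ i $ k\<close> and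
  \<open>- A $ i $ k * y $ i - y $ k * C $ i $ k = M $ k $ i\<close>, whose determinant is \<open>(y $ i)\<^sup>2 - (y $ k)\<^sup>2\<close>;
  on the diagonal both vanish because division by zero gives zero.
\<close>

lemma skew_decomposition:
  fixes M :: "real^'n^'n"
  assumes y: "y \<in> pos_orthant" "inj (\<lambda>i. y $ i)"
  defines "A \<equiv> \<chi> i k. - (y $ k * M $ i $ k + y $ i * M $ k $ i) / ((y $ i)\<^sup>2 - (y $ k)\<^sup>2)"
    and "C \<equiv> \<chi> i k. (y $ k * M $ k $ i + y $ i * M $ i $ k) / ((y $ i)\<^sup>2 - (y $ k)\<^sup>2)"
  shows "transpose A = - A" "transpose C = - C"
    "M = diag_mat (\<chi> i. M $ i $ i) + (A ** diag_mat y + diag_mat y ** C)"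
proof -
  define d where "d i k = (y $ i)\<^sup>2 - (y $ k)\<^sup>2" for i k
  have d: "d i k = - d k i" for i k
    by (simp add: d_def)
  have ne: "(y $ i)\<^sup>2 - (y $ k)\<^sup>2 \<noteq> 0" if "i \<noteq> k" for i k
    using y that by (auto simp: power2_eq_iff_nonneg pos_orthant_def less_imp_le dest: injD)
  show "transpose A = - A"
  proof (subst vec_eq_iff, subst vec_eq_iff, intro allI)
    fix i k
    show "transpose A $ i $ k = (- A) $ i $ k"
      unfolding A_def d_def[symmetric] using d[of k i] by (simp add: transpose_def add.commute)
  qed
  show "transpose C = - C"
  proof (subst vec_eq_iff, subst vec_eq_iff, intro allI)
    fix i k
    show "transpose C $ i $ k = (- C) $ i $ k"
      unfolding C_def d_def[symmetric] using d[of k i] by (simp add: transpose_def add.commute)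
  qed
  show "M = diag_mat (\<chi> i. M $ i $ i) + (A ** diag_mat y + diag_mat y ** C)"
  proof (subst vec_eq_iff, subst vec_eq_iff, intro allI)
    fix i k
    show "M $ i $ k = (diag_mat (\<chi> i. M $ i $ i) + (A ** diag_mat y + diag_mat y ** C)) $ i $ k"
    proof (cases "i = k")
      case True
      then show ?thesis by (simp add: mult_diag_mat_nth diag_mat_mult_nth A_def C_def)
    next
      case False
      then have "A $ i $ k * y $ k + y $ i * C $ i $ k = M $ i $ k"
        using ne[OF False] by (simp add: A_def C_def add_divide_distrib[symmetric] divide_eq_eq)
          (simp add: algebra_simps power2_eq_square)
      then show ?thesis using False by (simp add: mult_diag_mat_nth diag_mat_mult_nth)
    qed
  qed
qed

context isotropic_function
begin

lemma partial_eq: "y \<in> pos_orthant \<Longrightarrow> partial i g y = g' y (axis i 1)"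
  by (simp add: partial_def g'_eq)

lemma hessian_eq: "y \<in> pos_orthant \<Longrightarrow> hessian g y $ i $ j = g'' y (axis i 1) (axis j 1)"
  by (simp add: hessian_def partial_def g''_eq)

lemma g'_expansion:
  assumes "y \<in> pos_orthant"
  shows "g' y x = (\<Sum>i\<in>UNIV. partial i g y * x $ i)"
  by (subst axis_expansion[of x])
     (simp add: partial_eq[OF assms] blinfun.bilinear_simps mult.commute)

lemma g''_expansion:
  assumes "y \<in> pos_orthant"
  shows "g'' y x z = (\<Sum>i\<in>UNIV. \<Sum>j\<in>UNIV. hessian g y $ i $ j * x $ i * z $ j)"
  by (subst axis_expansion[of x], subst axis_expansion[of z])
     (simp add: hessian_eq[OF assms] blinfun.bilinear_simps blinfun.sum_left blinfun.sum_right sum_distrib_left mult_ac, rule sum.swap)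

text \<open>
  Write \<open>M = X + L\<close> with \<open>X\<close> diagonal and \<open>L = A ** D + D ** C\<close> as in the decomposition above, where
  \<open>D = diag_mat y\<close>. The part with \<open>X\<close> twice is the second derivative of \<open>g\<close>. By the infinitesimal
  invariances every term containing \<open>L\<close> is a first derivative, \<open>- w' D (A ** Z + Z ** C)\<close>, and first
  derivatives at \<open>D\<close> only see the diagonal. For \<open>Z = X\<close> the diagonal of \<open>A ** Z + Z ** C\<close> is zero;
  for \<open>Z = L\<close> one gets, after exchanging the names of the indices in half of the terms, the
  difference quotients in \<open>G_matrix\<close> and \<open>H_bar_matrix\<close>.
\<close>

lemma second_derivative_distinct:
  assumes y: "y \<in> pos_orthant" "inj (\<lambda>i. y $ i)"
  shows "w'' (diag_mat y) M M =
     (\<Sum>i\<in>UNIV. \<Sum>j\<in>UNIV. hessian g y $ i $ j * M $ i $ i * M $ j $ j) +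
     (\<Sum>i\<in>UNIV. \<Sum>j\<in>UNIV. G_matrix g y $ i $ j * (M $ i $ j)\<^sup>2
         + H_bar_matrix g y $ i $ j * (M $ i $ j * M $ j $ i))"
proof -
  define d where "d i k = (y $ i)\<^sup>2 - (y $ k)\<^sup>2" for i k
  define A :: "real^'n^'n" where "A = (\<chi> i k. - (y $ k * M $ i $ k + y $ i * M $ k $ i) / d i k)"
  define C :: "real^'n^'n" where "C = (\<chi> i k. (y $ k * M $ k $ i + y $ i * M $ i $ k) / d i k)"
  define x :: "real^'n" where "x = (\<chi> i. M $ i $ i)"
  define L where "L = A ** diag_mat y + diag_mat y ** C"
  note dec = skew_decomposition[OF y, of M, folded d_def, folded A_def C_def x_def L_def]
  let ?D = "diag_mat y" and ?X = "diag_mat x" and ?p = "\<lambda>i. partial i g y"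
  note D = GL_pos_diag_mat[OF y(1)]
  have LZ: "w'' ?D L Z = - w' ?D (A ** Z + Z ** C)" "w'' ?D Z L = - w' ?D (A ** Z + Z ** C)" for Z
    using infinitesimal_objectivity(2,3)[OF D dec(1), of Z]
      infinitesimal_isotropy(2,3)[OF D dec(2), of Z]
    by (simp_all add: L_def blinfun.bilinear_simps)
  have first: "w' ?D Z = (\<Sum>i\<in>UNIV. ?p i * Z $ i $ i)" for Z
  proof -
    obtain A' C' where dec': "transpose A' = - A'" "transpose C' = - C'"
      "Z = diag_mat (\<chi> i. Z $ i $ i) + (A' ** ?D + ?D ** C')"
      using skew_decomposition[OF y, of Z] by blast
    have "w' ?D Z = w' ?D (diag_mat (\<chi> i. Z $ i $ i))"
      by (subst dec'(3)) (simp add: blinfun.bilinear_simps infinitesimal_objectivity(1)[OF D dec'(1)]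
          infinitesimal_isotropy(1)[OF D dec'(2)])
    then show ?thesis by (simp add: w'_diag[OF y(1)] g'_expansion[OF y(1)])
  qed
  have AC0: "A $ i $ i = 0" "C $ i $ i = 0" for i by (simp_all add: A_def C_def d_def)
  have Lnth: "L $ i $ k = (if i = k then 0 else M $ i $ k)" for i k
    using arg_cong[OF dec(3), of "\<lambda>M. M $ i $ k"] by (simp add: x_def split: if_splits)
  have "w'' ?D M M = w'' ?D (?X + L) (?X + L)"
    using dec(3) by simp
  also have "\<dots> = w'' ?D ?X ?X - 2 * w' ?D (A ** ?X + ?X ** C) - w' ?D (A ** L + L ** C)"
    by (simp only: blinfun.add_left blinfun.add_right LZ) simp
  also have "w' ?D (A ** ?X + ?X ** C) = 0"
    by (simp add: first mult_diag_mat_nth diag_mat_mult_nth AC0)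
  also have "w'' ?D ?X ?X = (\<Sum>i\<in>UNIV. \<Sum>j\<in>UNIV. hessian g y $ i $ j * M $ i $ i * M $ j $ j)"
    by (simp add: w''_diag[OF y(1)] g''_expansion[OF y(1)] x_def)
  also have "w' ?D (A ** L + L ** C) = - (\<Sum>i\<in>UNIV. \<Sum>j\<in>UNIV. G_matrix g y $ i $ j * (M $ i $ j)\<^sup>2
         + H_bar_matrix g y $ i $ j * (M $ i $ j * M $ j $ i))"
  proof -
    \<comment> \<open>\<open>S\<close> carries the squares of \<open>M $ i $ k\<close> and \<open>T\<close> those of \<open>M $ k $ i\<close>; transposing the indices of \<open>T\<close>
      collects the factors of \<open>(M $ i $ k)\<^sup>2\<close> into a difference quotient.\<close>
    define S where "S i k = ?p i * (y $ i * (M $ i $ k)\<^sup>2 + y $ k * (M $ i $ k * M $ k $ i)) / d i k" for i k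
    define T where "T i k = ?p i * (y $ i * (M $ k $ i)\<^sup>2 + y $ k * (M $ i $ k * M $ k $ i)) / d i k" for i k
    have "w' ?D (A ** L + L ** C) = (\<Sum>i\<in>UNIV. \<Sum>k\<in>UNIV. ?p i * (A $ i $ k * L $ k $ i + L $ i $ k * C $ k $ i))"
      by (simp add: first matrix_matrix_mult_def sum_distrib_left sum.distrib distrib_left)
    also have "\<dots> = (\<Sum>i\<in>UNIV. \<Sum>k\<in>UNIV. - (S i k + T i k))"
    proof (intro sum.cong refl)
      fix i k
      have "C $ k $ i = - C $ i $ k"
        using arg_cong[OF dec(2), of "\<lambda>M. M $ i $ k"] by (simp add: transpose_def)
      moreover have "A $ i $ k * M $ k $ i - M $ i $ k * C $ i $ k =
        - (y $ i * (M $ i $ k)\<^sup>2 + y $ i * (M $ k $ i)\<^sup>2 + 2 * y $ k * (M $ i $ k * M $ k $ i)) / d i k"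
        by (simp add: A_def C_def diff_divide_distrib[symmetric] algebra_simps power2_eq_square)
      ultimately show "?p i * (A $ i $ k * L $ k $ i + L $ i $ k * C $ k $ i) = - (S i k + T i k)"
        by (cases "i = k") (simp_all add: Lnth AC0 S_def T_def d_def add_divide_distrib[symmetric] minus_divide_left algebra_simps)
    qed
    also have "\<dots> = - (\<Sum>i\<in>UNIV. \<Sum>k\<in>UNIV. S i k + T k i)"
      using sum.swap[of T UNIV UNIV] by (simp add: sum_negf sum.distrib sum_subtractf)
    also have "(\<Sum>i\<in>UNIV. \<Sum>k\<in>UNIV. S i k + T k i) = (\<Sum>i\<in>UNIV. \<Sum>j\<in>UNIV. G_matrix g y $ i $ j * (M $ i $ j)\<^sup>2
         + H_bar_matrix g y $ i $ j * (M $ i $ j * M $ j $ i))"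
    proof (intro sum.cong refl)
      fix i k
      show "S i k + T k i = G_matrix g y $ i $ k * (M $ i $ k)\<^sup>2
         + H_bar_matrix g y $ i $ k * (M $ i $ k * M $ k $ i)"
      proof (cases "i = k")
        case True
        then show ?thesis by (simp add: S_def T_def d_def G_matrix_def H_bar_matrix_def)
      next
        case False
        then have "y $ i \<noteq> y $ k" using y(2) by (auto dest: injD)
        moreover have "T k i = - (?p k * (y $ k * (M $ i $ k)\<^sup>2 + y $ i * (M $ i $ k * M $ k $ i))) / d i k"
        proof -
          have "d k i = - d i k" by (simp add: d_def)
          then show ?thesis by (simp add: T_def mult.commute)
        qed
        ultimately show ?thesis
          using False by (simp add: S_def d_def G_matrix_def H_bar_matrix_def add_divide_distrib[symmetric] diff_divide_distrib[symmetric] algebra_simps)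
      qed
    qed
    finally show ?thesis .
  qed
  finally show ?thesis by simp
qed

end

section \<open>Second derivative at arbitrary diagonal matrices\<close>

definition swap_entries :: "'n \<Rightarrow> 'n \<Rightarrow> real^'n \<Rightarrow> real^'n" where
  "swap_entries i j x = (\<chi> k. x $ Transposition.transpose i j k)"

lemma linear_swap_entries: "linear (swap_entries i j)"
  by (auto simp: linear_iff swap_entries_def vec_eq_iff)

lemma swap_entries_axis: "swap_entries i j (axis i r) = axis j r"
  by (auto simp: swap_entries_def vec_eq_iff axis_def Transposition.transpose_def)

lemma swap_entries_axis': "swap_entries i j (axis j r) = axis i r"
  by (auto simp: swap_entries_def vec_eq_iff axis_def Transposition.transpose_def)

lemma swap_entries_fixed: "y $ i = y $ j \<Longrightarrow> swap_entries i j y = y"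
  by (auto simp: swap_entries_def vec_eq_iff Transposition.transpose_def)

lemma swap_entries_decomp: "x = swap_entries i j x + (x $ i - x $ j) *\<^sub>R (axis i 1 - axis j 1)"
  by (auto simp: swap_entries_def vec_eq_iff Transposition.transpose_def axis_def)

lemma eventually_distinct:
  fixes y c :: "real^'n"
  assumes "inj (\<lambda>i. c $ i)"
  shows "\<forall>\<^sub>F \<epsilon> in at 0. inj (\<lambda>i. (y + \<epsilon> *\<^sub>R c) $ i)"
proof -
  have "\<forall>\<^sub>F \<epsilon> in at 0. i \<noteq> j \<longrightarrow> y $ i + \<epsilon> * c $ i \<noteq> y $ j + \<epsilon> * c $ j" for i j
  proof (cases "y $ i = y $ j")
    case True
    then show ?thesis using injD[OF assms, of i j] by (auto simp: eventually_at_filter)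
  next
    case False
    have "((\<lambda>\<epsilon>. (y $ i + \<epsilon> * c $ i) - (y $ j + \<epsilon> * c $ j)) \<longlongrightarrow> (y $ i + 0 * c $ i) - (y $ j + 0 * c $ j)) (at 0)"
      by (intro tendsto_intros)
    then have "\<forall>\<^sub>F \<epsilon> in at 0. (y $ i + \<epsilon> * c $ i) - (y $ j + \<epsilon> * c $ j) \<noteq> 0"
      using False by (intro tendsto_imp_eventually_ne) auto
    then show ?thesis by eventually_elim auto
  qed
  then have "\<forall>\<^sub>F \<epsilon> in at 0. \<forall>i j. i \<noteq> j \<longrightarrow> y $ i + \<epsilon> * c $ i \<noteq> y $ j + \<epsilon> * c $ j"
    by (intro eventually_all_finite)
  then show ?thesis by eventually_elim (auto simp: inj_def)
qed

lemma tendsto_quotient_derivative: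
  assumes u: "(u has_real_derivative U) (at a)" "u a = 0"
    and v: "(v has_real_derivative V) (at a)" "v a = 0" and V: "V \<noteq> 0"
  shows "((\<lambda>x. u x / v x) \<longlongrightarrow> U / V) (at a)"
proof -
  have "((\<lambda>x. (u x / (x - a)) / (v x / (x - a))) \<longlongrightarrow> U / V) (at a)"
    using u v V by (intro tendsto_divide) (auto simp: has_field_derivative_iff)
  then show ?thesis
    by (rule Lim_transform_eventually) (auto simp: eventually_at_filter)
qed

context isotropic_function
begin

lemma g_swap_entries: "y \<in> pos_orthant \<Longrightarrow> g (swap_entries i j y) = g y"
  using g_sym by (simp add: symmetric_on_pos_def swap_entries_def)

lemma g'_swap_entries:
  assumes "y \<in> pos_orthant" "y $ i = y $ j"
  shows "g' y (swap_entries i j z) = g' y z"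
  using dir_deriv_linear_comp[OF linear_swap_entries open_pos_orthant assms(1), of g i j g z]
    swap_entries_fixed[OF assms(2)]
  by (simp add: g'_eq[OF assms(1)] g_swap_entries)

lemma g''_swap_entries:
  assumes "y \<in> pos_orthant" "y $ i = y $ j"
  shows "g'' y (swap_entries i j z) (swap_entries i j u) = g'' y z u"
  using dir_deriv2_linear_comp[OF linear_swap_entries open_pos_orthant assms(1), of g i j g z u]
    swap_entries_fixed[OF assms(2)]
  by (simp add: g''_eq[OF assms(1)] g_swap_entries)

lemma partial_swap:
  assumes "y \<in> pos_orthant" "y $ i = y $ j"
  shows "partial i g y = partial j g y"
  using g'_swap_entries[OF assms, of "axis i 1"] assms by (simp add: partial_eq swap_entries_axis)

text \<open>
  If \<open>y $ i = y $ j\<close>, exchanging the entries \<open>i\<close> and \<open>j\<close> fixes \<open>y\<close>, so only the difference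
  \<open>c $ i - c $ j\<close> of the direction \<open>c\<close> contributes.
\<close>

lemma g''_difference:
  assumes "y \<in> pos_orthant" "y $ i = y $ j"
  shows "g'' y c (axis i 1) - g'' y c (axis j 1) = (c $ i - c $ j) * (hessian g y $ i $ i - hessian g y $ i $ j)"
proof -
  have "g'' y c (axis i 1) = g'' y (swap_entries i j c) (axis i 1)
      + (c $ i - c $ j) * (hessian g y $ i $ i - hessian g y $ j $ i)"
    by (subst swap_entries_decomp[of c i j]) (simp add: blinfun.bilinear_simps hessian_eq[OF assms(1)])
  moreover have "g'' y (swap_entries i j c) (axis i 1) = g'' y c (axis j 1)"
    using g''_swap_entries[OF assms, of c "axis j 1"] by (simp add: swap_entries_axis')
  moreover have "hessian g y $ j $ i = hessian g y $ i $ j"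
    using g''_swap_entries[OF assms, of "axis i 1" "axis j 1"]
    by (simp add: swap_entries_axis swap_entries_axis' hessian_eq[OF assms(1)])
  ultimately show ?thesis by simp
qed

lemma partial_line_has_derivative:
  assumes y: "y \<in> pos_orthant"
  shows "((\<lambda>\<epsilon>. partial i g (y + \<epsilon> *\<^sub>R c)) has_real_derivative g'' y c (axis i 1)) (at 0)"
proof -
  have "((\<lambda>\<epsilon>. g' (y + \<epsilon> *\<^sub>R c)) has_vector_derivative g'' y c) (at 0)"
    by (rule has_vector_derivative_compose[where f = g' and c = "\<lambda>\<epsilon>. y + \<epsilon> *\<^sub>R c"])
       (use g''[OF y] line_has_vector_derivative in auto)
  then have "((\<lambda>\<epsilon>. g' (y + \<epsilon> *\<^sub>R c) (axis i 1)) has_vector_derivative g'' y c (axis i 1)) (at 0)"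
    by (rule bounded_linear.has_vector_derivative[OF
         bounded_bilinear.bounded_linear_left[OF bounded_bilinear_blinfun_apply]])
  moreover have "\<forall>\<^sub>F \<epsilon> in nhds 0. partial i g (y + \<epsilon> *\<^sub>R c) = g' (y + \<epsilon> *\<^sub>R c) (axis i 1)"
    using eventually_line_in[OF open_pos_orthant y, of c] by eventually_elim (rule partial_eq)
  ultimately show ?thesis
    by (subst DERIV_cong_ev[OF refl _ refl]) (simp_all add: has_real_derivative_iff_has_vector_derivative)
qed

text \<open>
  At a pair \<open>i \<noteq> j\<close> with \<open>y $ i = y $ j\<close> both quotients are of the form \<open>0 / 0\<close>, by the symmetry of
  \<open>g\<close>. Along the line with direction \<open>c\<close> numerator and denominator are differentiable, and the
  factor \<open>c $ i - c $ j\<close> cancels from the quotient of the derivatives, which leaves the value in the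
  definitions of \<open>G_matrix\<close> and \<open>H_bar_matrix\<close>.
\<close>

lemma GH_tendsto:
  assumes y: "y \<in> pos_orthant" and c: "inj (\<lambda>i. c $ i)"
  shows "((\<lambda>\<epsilon>. G_matrix g (y + \<epsilon> *\<^sub>R c) $ i $ j) \<longlongrightarrow> G_matrix g y $ i $ j) (at 0)"
    and "((\<lambda>\<epsilon>. H_bar_matrix g (y + \<epsilon> *\<^sub>R c) $ i $ j) \<longlongrightarrow> H_bar_matrix g y $ i $ j) (at 0)"
proof -
  let ?y = "\<lambda>\<epsilon>. y + \<epsilon> *\<^sub>R c"
  define p where "p k \<epsilon> = partial k g (?y \<epsilon>)" for k \<epsilon>
  define r where "r k \<epsilon> = y $ k + \<epsilon> * c $ k" for k \<epsilon>
  define uG where "uG \<epsilon> = r i \<epsilon> * p i \<epsilon> - r j \<epsilon> * p j \<epsilon>" for \<epsilon>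
  define uH where "uH \<epsilon> = r j \<epsilon> * p i \<epsilon> - r i \<epsilon> * p j \<epsilon>" for \<epsilon>
  define v where "v \<epsilon> = (r i \<epsilon>)\<^sup>2 - (r j \<epsilon>)\<^sup>2" for \<epsilon>
  have dp: "(p k has_real_derivative g'' y c (axis k 1)) (at 0)" for k
    using partial_line_has_derivative[OF y, of k c] by (simp add: p_def[abs_def])
  have dr: "(r k has_real_derivative c $ k) (at 0)" for k
    unfolding r_def[abs_def] by (auto intro!: derivative_eq_intros)
  have [simp]: "p k 0 = partial k g y" "r k 0 = y $ k" for k
    by (simp_all add: p_def r_def)
  have duG: "(uG has_real_derivative c $ i * partial i g y + y $ i * g'' y c (axis i 1)
      - (c $ j * partial j g y + y $ j * g'' y c (axis j 1))) (at 0)"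
    unfolding uG_def[abs_def] by (auto intro!: derivative_eq_intros dp dr)
  have duH: "(uH has_real_derivative c $ j * partial i g y + y $ j * g'' y c (axis i 1)
      - (c $ i * partial j g y + y $ i * g'' y c (axis j 1))) (at 0)"
    unfolding uH_def[abs_def] by (auto intro!: derivative_eq_intros dp dr)
  have dv: "(v has_real_derivative 2 * y $ i * c $ i - 2 * y $ j * c $ j) (at 0)"
    unfolding v_def[abs_def] by (auto intro!: derivative_eq_intros dr)
  have ev: "\<forall>\<^sub>F \<epsilon> in at 0. uG \<epsilon> / v \<epsilon> = G_matrix g (?y \<epsilon>) $ i $ j \<and>
      uH \<epsilon> / v \<epsilon> = H_bar_matrix g (?y \<epsilon>) $ i $ j"
    if "i \<noteq> j"
    using eventually_distinct[OF c, of y]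
  proof eventually_elim
    case (elim \<epsilon>)
    then have "(?y \<epsilon>) $ i \<noteq> (?y \<epsilon>) $ j" using that by (metis injD)
    then show ?case
      using that by (simp add: uG_def uH_def v_def p_def r_def G_matrix_def H_bar_matrix_def)
  qed
  have "((\<lambda>\<epsilon>. uG \<epsilon> / v \<epsilon>) \<longlongrightarrow> G_matrix g y $ i $ j) (at 0) \<and>
     ((\<lambda>\<epsilon>. uH \<epsilon> / v \<epsilon>) \<longlongrightarrow> H_bar_matrix g y $ i $ j) (at 0)" if ij: "i \<noteq> j"
  proof (cases "y $ i = y $ j")
    case True
    have ne: "c $ i \<noteq> c $ j" using c ij by (auto dest: injD)
    have yi: "y $ i > 0" using y by (simp add: pos_orthant_def)
    have pp: "partial j g y = partial i g y" using partial_swap[OF y True] by simp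
    have gg: "g'' y c (axis j 1) = g'' y c (axis i 1) - (c $ i - c $ j) * (hessian g y $ i $ i - hessian g y $ i $ j)"
      using g''_difference[OF y True, of c] by simp
    have z: "uG 0 = 0" "uH 0 = 0" "v 0 = 0"
      using True pp by (simp_all add: uG_def uH_def v_def)
    have V: "2 * y $ i * c $ i - 2 * y $ j * c $ j \<noteq> 0"
      using True ne yi by (simp add: algebra_simps)
    have "(c $ i * partial i g y + y $ i * g'' y c (axis i 1)
      - (c $ j * partial j g y + y $ j * g'' y c (axis j 1))) / (2 * y $ i * c $ i - 2 * y $ j * c $ j)
      = ((c $ i - c $ j) * (partial i g y + y $ i * hessian g y $ i $ i - y $ i * hessian g y $ i $ j)) /
        ((c $ i - c $ j) * (2 * y $ i))"
      unfolding pp gg True[symmetric] by (rule arg_cong2[where f = "(/)"]) (simp_all add: algebra_simps)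
    also have "\<dots> = G_matrix g y $ i $ j"
      using True ij ne by (simp add: G_matrix_def)
    finally have G: "(c $ i * partial i g y + y $ i * g'' y c (axis i 1)
      - (c $ j * partial j g y + y $ j * g'' y c (axis j 1))) / (2 * y $ i * c $ i - 2 * y $ j * c $ j) = G_matrix g y $ i $ j" .
    have "(c $ j * partial i g y + y $ j * g'' y c (axis i 1)
      - (c $ i * partial j g y + y $ i * g'' y c (axis j 1))) / (2 * y $ i * c $ i - 2 * y $ j * c $ j)
      = ((c $ i - c $ j) * (y $ i * hessian g y $ i $ i - y $ i * hessian g y $ i $ j - partial i g y)) /
        ((c $ i - c $ j) * (2 * y $ i))"
      unfolding pp gg True[symmetric] by (rule arg_cong2[where f = "(/)"]) (simp_all add: algebra_simps)
    also have "\<dots> = H_bar_matrix g y $ i $ j"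
      using True ij ne by (simp add: H_bar_matrix_def)
    finally have H: "(c $ j * partial i g y + y $ j * g'' y c (axis i 1)
      - (c $ i * partial j g y + y $ i * g'' y c (axis j 1))) / (2 * y $ i * c $ i - 2 * y $ j * c $ j) = H_bar_matrix g y $ i $ j" .
    show ?thesis
      using tendsto_quotient_derivative[OF duG z(1) dv z(3) V] tendsto_quotient_derivative[OF duH z(2) dv z(3) V]
      by (simp only: G H)
  next
    case False
    have "y $ i > 0" "y $ j > 0" using y by (simp_all add: pos_orthant_def)
    then have "v 0 \<noteq> 0"
      using False by (simp add: v_def power2_eq_iff_nonneg)
    then have "((\<lambda>\<epsilon>. uG \<epsilon> / v \<epsilon>) \<longlongrightarrow> uG 0 / v 0) (at 0)" "((\<lambda>\<epsilon>. uH \<epsilon> / v \<epsilon>) \<longlongrightarrow> uH 0 / v 0) (at 0)"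
      using duG duH dv by (auto intro!: tendsto_divide dest!: DERIV_isCont simp: isCont_def)
    moreover have "uG 0 / v 0 = G_matrix g y $ i $ j" "uH 0 / v 0 = H_bar_matrix g y $ i $ j"
      using False ij by (simp_all add: uG_def uH_def v_def G_matrix_def H_bar_matrix_def)
    ultimately show ?thesis by simp
  qed
  then have *: "((\<lambda>\<epsilon>. G_matrix g (?y \<epsilon>) $ i $ j) \<longlongrightarrow> G_matrix g y $ i $ j) (at 0) \<and>
     ((\<lambda>\<epsilon>. H_bar_matrix g (?y \<epsilon>) $ i $ j) \<longlongrightarrow> H_bar_matrix g y $ i $ j) (at 0)" if "i \<noteq> j"
    using ev that by (auto elim!: Lim_transform_eventually elim: eventually_mono)
  have **: "((\<lambda>\<epsilon>. G_matrix g (?y \<epsilon>) $ i $ j) \<longlongrightarrow> G_matrix g y $ i $ j) (at 0) \<and>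
     ((\<lambda>\<epsilon>. H_bar_matrix g (?y \<epsilon>) $ i $ j) \<longlongrightarrow> H_bar_matrix g y $ i $ j) (at 0)" if "i = j"
    using that by (simp add: G_matrix_def H_bar_matrix_def)
  show "((\<lambda>\<epsilon>. G_matrix g (?y \<epsilon>) $ i $ j) \<longlongrightarrow> G_matrix g y $ i $ j) (at 0)"
    "((\<lambda>\<epsilon>. H_bar_matrix g (?y \<epsilon>) $ i $ j) \<longlongrightarrow> H_bar_matrix g y $ i $ j) (at 0)"
    using * ** by auto
qed

lemma hessian_tendsto:
  assumes y: "y \<in> pos_orthant"
  shows "((\<lambda>\<epsilon>. hessian g (y + \<epsilon> *\<^sub>R c) $ i $ j) \<longlongrightarrow> hessian g y $ i $ j) (at 0)"
proof -
  have "isCont g'' y"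
    using g''_continuous y open_pos_orthant continuous_on_eq_continuous_at by blast
  moreover have "((\<lambda>\<epsilon>. y + \<epsilon> *\<^sub>R c) \<longlongrightarrow> y + 0 *\<^sub>R c) (at 0)"
    by (intro tendsto_intros)
  ultimately have "((\<lambda>\<epsilon>. g'' (y + \<epsilon> *\<^sub>R c)) \<longlongrightarrow> g'' y) (at 0)"
    by (intro isCont_tendsto_compose[of y g'']) auto
  then have "((\<lambda>\<epsilon>. g'' (y + \<epsilon> *\<^sub>R c) (axis i 1) (axis j 1)) \<longlongrightarrow> hessian g y $ i $ j) (at 0)"
    unfolding hessian_eq[OF y] by (intro tendsto_intros)
  moreover have "\<forall>\<^sub>F \<epsilon> in at 0. y + \<epsilon> *\<^sub>R c \<in> pos_orthant"
    using eventually_line_in[OF open_pos_orthant y, of c] by (simp add: eventually_at_filter eventually_mono)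
  then have "\<forall>\<^sub>F \<epsilon> in at 0. g'' (y + \<epsilon> *\<^sub>R c) (axis i 1) (axis j 1) = hessian g (y + \<epsilon> *\<^sub>R c) $ i $ j"
    by eventually_elim (simp add: hessian_eq)
  ultimately show ?thesis
    by (rule Lim_transform_eventually)
qed

text \<open>
  Both sides are continuous along the line \<open>y + \<epsilon> *\<^sub>R c\<close> as \<open>\<epsilon>\<close> tends to \<open>0\<close>, and they agree for
  \<open>\<epsilon> \<noteq> 0\<close> near \<open>0\<close>, where the entries are distinct.
\<close>

lemma second_derivative_formula:
  assumes y: "y \<in> pos_orthant"
  shows "w'' (diag_mat y) M M =
     (\<Sum>i\<in>UNIV. \<Sum>j\<in>UNIV. hessian g y $ i $ j * M $ i $ i * M $ j $ j) +
     (\<Sum>i\<in>UNIV. \<Sum>j\<in>UNIV. G_matrix g y $ i $ j * (M $ i $ j)\<^sup>2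
         + H_bar_matrix g y $ i $ j * (M $ i $ j * M $ j $ i))" (is "_ = ?R y")
proof -
  obtain c :: "real^'n" where c: "inj (\<lambda>i. c $ i)"
    using exists_distinct_weights by blast
  let ?y = "\<lambda>\<epsilon>. y + \<epsilon> *\<^sub>R c"
  have "isCont w'' (diag_mat y)"
    using w''_continuous GL_pos_diag_mat[OF y] open_GL_pos continuous_on_eq_continuous_at by blast
  moreover have "((\<lambda>\<epsilon>. diag_mat (?y \<epsilon>)) \<longlongrightarrow> diag_mat (?y 0)) (at 0)"
    unfolding linear_add[OF linear_diag_mat] linear_scale[OF linear_diag_mat] by (intro tendsto_intros)
  ultimately have "((\<lambda>\<epsilon>. w'' (diag_mat (?y \<epsilon>))) \<longlongrightarrow> w'' (diag_mat y)) (at 0)"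
    by (intro isCont_tendsto_compose[of "diag_mat y" w'']) auto
  then have lhs: "((\<lambda>\<epsilon>. w'' (diag_mat (?y \<epsilon>)) M M) \<longlongrightarrow> w'' (diag_mat y) M M) (at 0)"
    by (intro tendsto_intros)
  have rhs: "((\<lambda>\<epsilon>. ?R (?y \<epsilon>)) \<longlongrightarrow> ?R y) (at 0)"
    by (intro tendsto_intros hessian_tendsto GH_tendsto y c)
  have "\<forall>\<^sub>F \<epsilon> in at 0. ?y \<epsilon> \<in> pos_orthant"
    using eventually_line_in[OF open_pos_orthant y, of c] by (simp add: eventually_at_filter eventually_mono)
  then have ev: "\<forall>\<^sub>F \<epsilon> in at 0. ?R (?y \<epsilon>) = w'' (diag_mat (?y \<epsilon>)) M M"
    using eventually_distinct[OF c, of y] by eventually_elim (rule second_derivative_distinct[symmetric])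
  show ?thesis
    by (rule tendsto_unique[OF _ lhs Lim_transform_eventually[OF rhs ev]]) simp
qed

end

section \<open>Majorization and Schur convexity\<close>

text \<open>
  An explicit ordering of the index type that sorts \<open>x\<close>. It turns statements about the list into
  sums over indices, where derivatives can be taken.
\<close>

lemma decreasing_list_enumeration:
  fixes x :: "real^'n"
  obtains e where "bij_betw e {..<CARD('n)} (UNIV :: 'n set)"
    and "\<And>j. j < CARD('n) \<Longrightarrow> decreasing_list x ! j = x $ e j"
    and "\<And>j k. j \<le> k \<Longrightarrow> k < CARD('n) \<Longrightarrow> x $ e k \<le> x $ e j"
proof -
  obtain us :: "'n list" where us: "set us = UNIV" "distinct us"
    using finite_distinct_list[of "UNIV :: 'n set"] by auto
  define vs where "vs = sort_key (\<lambda>i. x $ i) us"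
  have vs: "set vs = UNIV" "distinct vs" "length vs = CARD('n)"
    using us distinct_card[OF us(2)] by (simp_all add: vs_def)
  have "mset vs = mset_set UNIV"
    using vs by (metis mset_set_set)
  then have "image_mset (\<lambda>i. x $ i) (mset_set UNIV) = mset (map (\<lambda>i. x $ i) vs)"
    by simp
  then have "sorted_list_of_multiset (image_mset (\<lambda>i. x $ i) (mset_set UNIV)) = map (\<lambda>i. x $ i) vs"
    by (simp only: sorted_list_of_multiset_mset) (simp add: sorted_sort_id vs_def)
  then have dec: "decreasing_list x = map (\<lambda>i. x $ i) (rev vs)"
    by (simp add: decreasing_list_def rev_map)
  show ?thesis
  proof (rule that[of "\<lambda>j. rev vs ! j"])
    show "bij_betw (\<lambda>j. rev vs ! j) {..<CARD('n)} UNIV"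
      using vs by (intro bij_betw_nth) auto
    show "decreasing_list x ! j = x $ (rev vs ! j)" if "j < CARD('n)" for j
      using that vs by (simp add: dec)
    have "sorted (map (\<lambda>i. x $ i) vs)" by (simp add: vs_def)
    then have "sorted_wrt (\<lambda>a b. b \<le> a) (map (\<lambda>i. x $ i) (rev vs))"
      by (simp add: rev_map[symmetric] sorted_wrt_rev)
    then show "x $ (rev vs ! k) \<le> x $ (rev vs ! j)" if "j \<le> k" "k < CARD('n)" for j k
      using that vs by (cases "j = k") (auto simp: sorted_wrt_iff_nth_less)
  qed
qed

text \<open>
  Outside their intersection, \<open>T\<close> and the initial segment of the same size have equally many
  elements, and the value of \<open>d\<close> at the last element of the segment separates the two parts.
\<close>

lemma sum_le_initial_sum:
  fixes d :: "nat \<Rightarrow> real"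
  assumes d: "\<And>j k. j \<le> k \<Longrightarrow> k < n \<Longrightarrow> d k \<le> d j" and T: "T \<subseteq> {..<n}"
  shows "sum d T \<le> sum d {..<card T}"
proof -
  let ?K = "{..<card T}"
  have fin: "finite T" using T finite_subset by blast
  have le: "card T \<le> n" using card_mono[OF _ T] by simp
  have card: "card (T - ?K) = card (?K - T)"
  proof -
    have "card T = card (T - ?K) + card (T \<inter> ?K)" "card ?K = card (?K - T) + card (T \<inter> ?K)"
      using fin by (metis card_Diff_subset_Int add.commute card_Int_Diff finite_lessThan Int_commute)+
    then show ?thesis by simp
  qed
  have "sum d (T - ?K) \<le> of_nat (card (T - ?K)) * d (card T - 1)"
    by (rule sum_bounded_above) (use T in \<open>auto intro!: d\<close>)
  also have "\<dots> \<le> sum d (?K - T)"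
    unfolding card by (rule sum_bounded_below) (use le in \<open>auto intro!: d\<close>)
  finally have "sum d (T - ?K) \<le> sum d (?K - T)" .
  then show ?thesis
    using sum.Int_Diff[OF fin, of d ?K] sum.Int_Diff[of ?K d T] by (simp add: Int_commute)
qed

lemma initial_sum_eq:
  fixes x :: "real^'n"
  assumes "k \<le> CARD('n)"
  obtains S where "card S = k" "(\<Sum>j<k. decreasing_list x ! j) = (\<Sum>i\<in>S. x $ i)"
proof -
  obtain e where e: "bij_betw e {..<CARD('n)} (UNIV :: 'n set)"
    "\<And>j. j < CARD('n) \<Longrightarrow> decreasing_list x ! j = x $ e j"
    using decreasing_list_enumeration[of x] by metis
  have inj: "inj_on e {..<k}"
    using e(1) assms by (auto simp: bij_betw_def intro: inj_on_subset)
  show ?thesis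
  proof (rule that[of "e ` {..<k}"])
    show "card (e ` {..<k}) = k" using inj by (simp add: card_image)
    show "(\<Sum>j<k. decreasing_list x ! j) = (\<Sum>i\<in>e ` {..<k}. x $ i)"
      using assms e(2) by (simp add: sum.reindex[OF inj])
  qed
qed

text \<open>
  Together with \<open>initial_sum_eq\<close> this says that the partial sums in the definition of majorization
  are the maxima of the sums over index sets of given size.
\<close>

lemma sum_le_top_sum:
  fixes x :: "real^'n"
  shows "(\<Sum>i\<in>S. x $ i) \<le> (\<Sum>j<card S. decreasing_list x ! j)"
proof -
  obtain e where e: "bij_betw e {..<CARD('n)} (UNIV :: 'n set)"
    "\<And>j. j < CARD('n) \<Longrightarrow> decreasing_list x ! j = x $ e j"
    "\<And>j k. j \<le> k \<Longrightarrow> k < CARD('n) \<Longrightarrow> x $ e k \<le> x $ e j"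
    using decreasing_list_enumeration[of x] by metis
  define T where "T = {j\<in>{..<CARD('n)}. e j \<in> S}"
  have img: "e ` T = S" and inj: "inj_on e T"
    using e(1) by (auto simp: bij_betw_def T_def inj_on_def image_iff set_eq_iff) (metis lessThan_iff)
  have "(\<Sum>i\<in>S. x $ i) = (\<Sum>j\<in>T. x $ e j)"
    by (simp add: img[symmetric] sum.reindex[OF inj])
  also have "\<dots> \<le> (\<Sum>j<card T. x $ e j)"
    by (rule sum_le_initial_sum[where n = "CARD('n)"]) (use e(3) in \<open>auto simp: T_def\<close>)
  also have "card T = card S"
    using card_image[OF inj] img by simp
  also have "(\<Sum>j<card S. x $ e j) = (\<Sum>j<card S. decreasing_list x ! j)"
    using e(2) card_mono[of UNIV S] by (intro sum.cong) auto
  finally show ?thesis .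
qed

lemma total_sum_eq: "(\<Sum>j<CARD('n). decreasing_list x ! j) = (\<Sum>i\<in>UNIV. x $ i)" for x :: "real^'n"
proof -
  obtain S :: "'n set" where "card S = CARD('n)" "(\<Sum>j<CARD('n). decreasing_list x ! j) = (\<Sum>i\<in>S. x $ i)"
    using initial_sum_eq[of "CARD('n)" x] by blast
  then show ?thesis by (metis card_subset_eq finite subset_UNIV)
qed

text \<open>
  A sum of \<open>z = x + t *\<^sub>R (axis j 1 - axis i 1)\<close> over an index set \<open>S\<close> exceeds that of \<open>x\<close> only if \<open>S\<close>
  contains \<open>j\<close> and not \<open>i\<close>; then the sum of \<open>x\<close> over \<open>S\<close> with \<open>j\<close> replaced by \<open>i\<close> is at least as
  large, since \<open>t \<le> x $ i - x $ j\<close>.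
\<close>

lemma transfer_majorized:
  fixes x :: "real^'n"
  assumes ij: "i \<noteq> j" and t: "0 \<le> t" "t \<le> x $ i - x $ j"
  shows "x + t *\<^sub>R (axis j 1 - axis i 1) \<prec> x"
proof -
  define z where "z = x + t *\<^sub>R (axis j 1 - axis i 1)"
  have z: "z $ k = x $ k + (if k = j then t else if k = i then - t else 0)" for k
    using ij by (simp add: z_def axis_def)
  have sumz: "(\<Sum>k\<in>S. z $ k) = (\<Sum>k\<in>S. x $ k) + (if j \<in> S then t else 0) - (if i \<in> S then t else 0)" for S
  proof -
    have "z $ k = x $ k + (if k = j then t else 0) - (if k = i then t else 0)" for k
      using ij by (simp add: z)
    then show ?thesis by (simp add: sum.distrib sum_subtractf)
  qed
  have "(\<Sum>a<k. decreasing_list z ! a) \<le> (\<Sum>a<k. decreasing_list x ! a)" if k: "k \<le> CARD('n)" for k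
  proof -
    obtain S :: "'n set" where S: "card S = k" "(\<Sum>a<k. decreasing_list z ! a) = (\<Sum>a\<in>S. z $ a)"
      using initial_sum_eq[OF k, of z] by blast
    show ?thesis
    proof (cases "j \<in> S \<and> i \<notin> S")
      case True
      define S' where "S' = insert i (S - {j})"
      have "card S' = k"
        using True S(1) card_Suc_Diff1[of S j] by (simp add: S'_def)
      moreover have "(\<Sum>a\<in>S'. x $ a) = x $ i + (\<Sum>a\<in>S. x $ a) - x $ j"
        using True by (simp add: S'_def sum_diff1)
      ultimately show ?thesis
        using sum_le_top_sum[of x S'] True t by (simp add: S sumz)
    next
      case False
      then have "(\<Sum>a\<in>S. z $ a) \<le> (\<Sum>a\<in>S. x $ a)"
        using t by (auto simp: sumz)
      then show ?thesis
        using sum_le_top_sum[of x S] S by simp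
    qed
  qed
  moreover have "(\<Sum>a<CARD('n). decreasing_list z ! a) = (\<Sum>a<CARD('n). decreasing_list x ! a)"
    by (simp add: total_sum_eq sumz)
  ultimately show ?thesis
    by (simp add: majorized_def z_def[symmetric])
qed

text \<open>
  Summation by parts: the sum is at least the full sum of \<open>a\<close>, which is \<open>0\<close>, times the last \<open>b\<close>.
\<close>

lemma abel_sum_nonneg:
  fixes a b :: "nat \<Rightarrow> real"
  assumes A: "\<And>k. k \<le> n \<Longrightarrow> (\<Sum>j<k. a j) \<ge> 0" "(\<Sum>j<n. a j) = 0"
    and b: "\<And>j. Suc j < n \<Longrightarrow> b (Suc j) \<le> b j"
  shows "(\<Sum>j<n. a j * b j) \<ge> 0"
proof (cases n)
  case (Suc m)
  have "(\<Sum>j<Suc k. a j) * b k \<le> (\<Sum>j<Suc k. a j * b j)" if "k \<le> m" for k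
    using that
  proof (induction k)
    case (Suc k)
    have "(\<Sum>j<Suc k. a j) * b (Suc k) \<le> (\<Sum>j<Suc k. a j) * b k"
      using Suc.prems \<open>n = Suc m\<close> by (intro mult_left_mono b A) auto
    with Suc show ?case by (simp add: distrib_right)
  qed simp
  from this[of m] Suc A(2) show ?thesis by simp
qed simp

text \<open>
  Permute \<open>y\<close> so that one enumeration of the indices sorts both \<open>x\<close> and \<open>y\<close>. Every point of the
  segment between them is then decreasing along this enumeration, and so are the partial derivatives
  there. The partial sums of \<open>y - x\<close> are nonnegative with total \<open>0\<close>, so summation by parts shows that
  \<open>h\<close> does not decrease from \<open>x\<close> to \<open>y\<close>.
\<close>

lemma schur_convexI:
  fixes h :: "real^'n \<Rightarrow> real" and D :: "'n \<Rightarrow> real^'n \<Rightarrow> real"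
  assumes sym: "\<And>p x. bij p \<Longrightarrow> h (\<chi> i. x $ p i) = h x"
    and deriv: "\<And>x v t. ((\<lambda>t. h (x + t *\<^sub>R v)) has_real_derivative (\<Sum>k\<in>UNIV. v $ k * D k (x + t *\<^sub>R v))) (at t)"
    and D: "\<And>x i j. x $ j \<le> x $ i \<Longrightarrow> D j x \<le> D i x"
  shows "schur_convex h"
  unfolding schur_convex_def
proof (intro allI impI)
  fix x y :: "real^'n"
  assume xy: "x \<prec> y"
  let ?N = "CARD('n)"
  obtain e where e: "bij_betw e {..<?N} (UNIV :: 'n set)"
    "\<And>j. j < ?N \<Longrightarrow> decreasing_list x ! j = x $ e j"
    "\<And>j k. j \<le> k \<Longrightarrow> k < ?N \<Longrightarrow> x $ e k \<le> x $ e j"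
    using decreasing_list_enumeration[of x] by metis
  obtain e' where e': "bij_betw e' {..<?N} (UNIV :: 'n set)"
    "\<And>j. j < ?N \<Longrightarrow> decreasing_list y ! j = y $ e' j"
    "\<And>j k. j \<le> k \<Longrightarrow> k < ?N \<Longrightarrow> y $ e' k \<le> y $ e' j"
    using decreasing_list_enumeration[of y] by metis
  define p where "p = e' \<circ> inv_into {..<?N} e"
  have "bij p"
    unfolding p_def by (rule bij_betw_trans[OF bij_betw_inv_into[OF e(1)] e'(1)])
  define z where "z = (\<chi> i. y $ p i)"
  have z: "z $ e j = y $ e' j" if "j < ?N" for j
    using that e(1) by (simp add: z_def p_def bij_betw_inv_into_left[OF e(1)])
  define v where "v = z - x"
  define f where "f t = h (x + t *\<^sub>R v)" for t
  have "f 0 \<le> f 1"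
  proof (rule DERIV_nonneg_imp_nondecreasing[where f = f])
    fix t :: real assume t: "0 \<le> t" "t \<le> 1"
    let ?c = "x + t *\<^sub>R v"
    have c: "?c $ e j = (1 - t) * x $ e j + t * y $ e' j" if "j < ?N" for j
      using z[OF that] by (simp add: v_def algebra_simps)
    have "0 \<le> (\<Sum>j<?N. v $ e j * D (e j) ?c)"
    proof (rule abel_sum_nonneg)
      have partial_sum: "(\<Sum>j<k. v $ e j) = (\<Sum>j<k. decreasing_list y ! j) - (\<Sum>j<k. decreasing_list x ! j)" if "k \<le> ?N" for k
        using that by (simp add: v_def z e(2) e'(2) sum_subtractf)
      show "0 \<le> (\<Sum>j<k. v $ e j)" if "k \<le> ?N" for k
        using xy that by (cases "k = 0") (simp_all add: majorized_def partial_sum)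
      show "(\<Sum>j<?N. v $ e j) = 0"
        using xy by (simp add: majorized_def partial_sum)
      show "D (e (Suc j)) ?c \<le> D (e j) ?c" if "Suc j < ?N" for j
      proof (rule D)
        show "?c $ e (Suc j) \<le> ?c $ e j"
          unfolding c[OF that] c[OF Suc_lessD[OF that]]
          using t that e(3)[of j "Suc j"] e'(3)[of j "Suc j"]
          by (intro add_mono mult_left_mono) auto
      qed
    qed
    also have "\<dots> = (\<Sum>k\<in>UNIV. v $ k * D k ?c)"
      by (rule sum.reindex_bij_betw[OF e(1)])
    finally show "\<exists>d. (f has_real_derivative d) (at t) \<and> 0 \<le> d"
      using deriv[of x v t] unfolding f_def[abs_def] by blast
  qed simp
  then show "h x \<le> h y"
    using sym[OF \<open>bij p\<close>, of y] by (simp add: f_def v_def z_def[symmetric])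
qed

text \<open>
  Moving a small amount from the larger entry \<open>i\<close> to the smaller entry \<open>j\<close> gives a majorized vector,
  so the derivative of \<open>h\<close> in that direction, \<open>D j x - D i x\<close>, cannot be positive.
\<close>

lemma schur_convexD:
  fixes h :: "real^'n \<Rightarrow> real" and D :: "'n \<Rightarrow> real^'n \<Rightarrow> real"
  assumes schur: "schur_convex h"
    and deriv: "\<And>x v t. ((\<lambda>t. h (x + t *\<^sub>R v)) has_real_derivative (\<Sum>k\<in>UNIV. v $ k * D k (x + t *\<^sub>R v))) (at t)"
    and less: "x $ j < x $ i"
  shows "D j x \<le> D i x"
proof (rule ccontr)
  assume "\<not> D j x \<le> D i x"
  let ?v = "axis j 1 - axis i 1 :: real^'n"
  have ij: "i \<noteq> j" using less by auto
  have "(\<Sum>k\<in>UNIV. ?v $ k * D k x) = D j x - D i x"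
    by (simp add: axis_def left_diff_distrib sum_subtractf if_distrib[of "\<lambda>t. t * _"] cong: if_cong)
  then have "((\<lambda>t. h (x + t *\<^sub>R ?v)) has_real_derivative D j x - D i x) (at 0)"
    using deriv[of x ?v 0] by simp
  moreover have "D j x - D i x > 0" using \<open>\<not> D j x \<le> D i x\<close> by simp
  ultimately obtain d where d: "d > 0" "\<And>s. 0 < s \<Longrightarrow> s < d \<Longrightarrow> h x < h (x + s *\<^sub>R ?v)"
    using DERIV_pos_inc_right[of "\<lambda>t. h (x + t *\<^sub>R ?v)" "D j x - D i x" 0] by auto
  define s where "s = min (d / 2) (x $ i - x $ j)"
  have s: "0 < s" "s < d" "s \<le> x $ i - x $ j"
    using d less by (auto simp: s_def)
  have "h (x + s *\<^sub>R ?v) \<le> h x"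
    using schur transfer_majorized[OF ij, of s x] s by (simp add: schur_convex_def)
  with d(2)[OF s(1,2)] show False by simp
qed

section \<open>Rank one convexity\<close>

definition outer :: "real^'n \<Rightarrow> real^'n \<Rightarrow> real^'n^'n" where
  "outer a b = (\<chi> i j. a $ i * b $ j)"

lemma mult_outer_mult: "P ** outer a b ** Q = outer (P *v a) (transpose Q *v b)"
  by (simp add: vec_eq_iff outer_def matrix_matrix_mult_def matrix_vector_mult_def transpose_def
      sum_distrib_left sum_distrib_right mult_ac)

lemma exp_vec_has_vector_derivative:
  "((\<lambda>t. \<chi> i. exp (x $ i + t * v $ i)) has_vector_derivative (\<chi> i. v $ i * exp (x $ i + t * v $ i))) (at t)"
  for x v :: "real^'n"
proof -
  have "((\<lambda>t. \<Sum>i\<in>UNIV. exp (x $ i + t * v $ i) *\<^sub>R axis i (1::real)) has_vector_derivative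
     (\<Sum>i\<in>UNIV. (v $ i * exp (x $ i + t * v $ i)) *\<^sub>R axis i 1)) (at t)"
    by (auto intro!: derivative_eq_intros has_vector_derivative_sum sum.cong)
  then show ?thesis
    using axis_expansion[of "\<chi> i. v $ i * exp (x $ i + t * v $ i)"]
      axis_expansion[of "\<chi> i. exp (x $ i + t * v $ i)" for t] by simp
qed

context isotropic_function
begin

lemma log_energy_has_derivative:
  assumes h: "\<And>x. h x = g (\<chi> i. exp (x $ i))"
  shows "((\<lambda>t. h (x + t *\<^sub>R v)) has_real_derivative
    (\<Sum>k\<in>UNIV. v $ k * (exp ((x + t *\<^sub>R v) $ k) * partial k g (\<chi> i. exp ((x + t *\<^sub>R v) $ i))))) (at t)"
proof -
  let ?c = "\<lambda>t. \<chi> i. exp (x $ i + t * v $ i)"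
  have pos: "?c t \<in> pos_orthant" by (simp add: pos_orthant_def)
  have "((\<lambda>t. g (?c t)) has_vector_derivative g' (?c t) (\<chi> i. v $ i * exp (x $ i + t * v $ i))) (at t)"
    by (rule has_vector_derivative_compose[where f = g and c = ?c, OF g'[OF pos] exp_vec_has_vector_derivative])
  then show ?thesis
    by (simp add: h has_real_derivative_iff_has_vector_derivative g'_expansion[OF pos] mult_ac)
qed

text \<open>
  With \<open>y\<close> the entrywise exponential of \<open>x\<close>, the partial derivatives of \<open>h\<close> at \<open>x\<close> are
  \<open>y $ i * partial i g y\<close>, so for distinct entries the claim is the derivative criterion for Schur
  convexity; equal entries follow by passing to the limit.
\<close>

lemma G_nonneg_if_schur_convex:
  assumes h: "\<And>x. h x = g (\<chi> i. exp (x $ i))" and schur: "schur_convex h"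
    and y: "y \<in> pos_orthant"
  shows "G_matrix g y $ i $ j \<ge> 0"
proof -
  have less: "y $ j * partial j g y \<le> y $ i * partial i g y"
    if "y \<in> pos_orthant" "y $ j < y $ i" for i j and y :: "real^'n"
  proof -
    define x :: "real^'n" where "x = (\<chi> i. ln (y $ i))"
    have ypos: "y $ k > 0" for k using that by (simp add: pos_orthant_def)
    have "(\<chi> i. exp (x $ i)) = y" using ypos by (simp add: x_def vec_eq_iff)
    moreover have "x $ j < x $ i" using that ypos by (simp add: x_def)
    ultimately show ?thesis
      using schur_convexD[OF schur log_energy_has_derivative[OF h], of x j i] ypos by (simp add: x_def)
  qed
  have ne: "G_matrix g y $ i $ j \<ge> 0" if y: "y \<in> pos_orthant" "y $ i \<noteq> y $ j" for y :: "real^'n"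
  proof -
    have "y $ i > 0" "y $ j > 0" using y by (simp_all add: pos_orthant_def)
    then show ?thesis
    proof (cases "y $ i < y $ j")
      case True
      then have "(y $ i)\<^sup>2 \<le> (y $ j)\<^sup>2"
        using \<open>y $ i > 0\<close> by (intro power_mono) auto
      then show ?thesis
        using less[OF y(1) True] y(2) by (simp add: G_matrix_def divide_nonpos_nonpos)
    next
      case False
      then have "(y $ j)\<^sup>2 \<le> (y $ i)\<^sup>2"
        using \<open>y $ j > 0\<close> by (intro power_mono) auto
      then show ?thesis
        using less[OF y(1), of j i] False y(2) by (simp add: G_matrix_def)
    qed
  qed
  obtain c :: "real^'n" where c: "inj (\<lambda>i. c $ i)"
    using exists_distinct_weights by blast
  have "\<forall>\<^sub>F \<epsilon> in at 0. y + \<epsilon> *\<^sub>R c \<in> pos_orthant"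
    using eventually_line_in[OF open_pos_orthant y, of c] by (simp add: eventually_at_filter eventually_mono)
  then have "\<forall>\<^sub>F \<epsilon> in at 0. 0 \<le> G_matrix g (y + \<epsilon> *\<^sub>R c) $ i $ j"
    using eventually_distinct[OF c, of y]
  proof eventually_elim
    case (elim \<epsilon>)
    then show ?case
      using ne[OF elim(1)] injD[OF elim(2), of i j] by (cases "i = j") (auto simp: G_matrix_def[of _ _ ] )
  qed
  then show ?thesis
    by (rule tendsto_lowerbound[OF GH_tendsto(1)[OF y c]]) simp
qed

text \<open>
  The denominator of \<open>G_matrix g y $ i $ j\<close> has the sign of \<open>y $ i - y $ j\<close>, so the partial derivatives
  of \<open>h\<close> are ordered like the entries; at equal entries they agree because \<open>g\<close> is symmetric.
\<close>

lemma schur_convex_if_G_nonneg: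
  assumes h: "\<And>x. h x = g (\<chi> i. exp (x $ i))"
    and G: "\<And>y i j. y \<in> pos_orthant \<Longrightarrow> i \<noteq> j \<Longrightarrow> G_matrix g y $ i $ j \<ge> 0"
  shows "schur_convex h"
proof (rule schur_convexI[OF _ log_energy_has_derivative[OF h]])
  fix p :: "'n \<Rightarrow> 'n" and x :: "real^'n"
  have "(\<chi> i. exp (x $ i)) \<in> pos_orthant" by (simp add: pos_orthant_def)
  then show "h (\<chi> i. x $ p i) = h x" if "bij p"
    using g_sym that unfolding h symmetric_on_pos_def by force
next
  fix x :: "real^'n" and i j
  assume le: "x $ j \<le> x $ i"
  let ?y = "\<chi> i. exp (x $ i)"
  have y: "?y \<in> pos_orthant" by (simp add: pos_orthant_def)
  show "exp (x $ j) * partial j g ?y \<le> exp (x $ i) * partial i g ?y"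
  proof (cases "x $ i = x $ j")
    case True
    then show ?thesis using partial_swap[OF y, of i j] by simp
  next
    case False
    then have "i \<noteq> j" by auto
    have "(exp (x $ j))\<^sup>2 < (exp (x $ i))\<^sup>2"
      using False le by (intro power_strict_mono) auto
    then show ?thesis
      using G[OF y \<open>i \<noteq> j\<close>] False le \<open>i \<noteq> j\<close> by (simp add: G_matrix_def zero_le_divide_iff)
  qed
qed

lemma rank_one_convex_iff:
  "rank_one_convex w \<longleftrightarrow> (\<forall>F\<in>GL_pos. \<forall>a b. w'' F (outer a b) (outer a b) \<ge> 0)"
proof -
  have "(\<Sum>i\<in>UNIV. \<Sum>j\<in>UNIV. \<Sum>k\<in>UNIV. \<Sum>l\<in>UNIV.
       partial_entry i j (partial_entry k l w) F * a $ i * b $ j * a $ k * b $ l)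
     = w'' F (outer a b) (outer a b)" if F: "F \<in> GL_pos" for F a b
  proof -
    have left: "w'' F M Z = (\<Sum>i\<in>UNIV. \<Sum>j\<in>UNIV. M $ i $ j * w'' F (unit_mat i j) Z)" for M Z
      by (subst unit_mat_expansion[of M]) (simp add: blinfun.bilinear_simps blinfun.sum_left blinfun.sum_right)
    have right: "w'' F Z M = (\<Sum>k\<in>UNIV. \<Sum>l\<in>UNIV. M $ k $ l * w'' F Z (unit_mat k l))" for M Z
      by (subst unit_mat_expansion[of M]) (simp add: blinfun.bilinear_simps blinfun.sum_right)
    have "w'' F (outer a b) (outer a b) = (\<Sum>i\<in>UNIV. \<Sum>j\<in>UNIV. \<Sum>k\<in>UNIV. \<Sum>l\<in>UNIV.
       outer a b $ i $ j * (outer a b $ k $ l * w'' F (unit_mat i j) (unit_mat k l)))"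
      unfolding left[of "outer a b" "outer a b"] sum_distrib_left[symmetric]
      unfolding right[of _ "outer a b"] ..
    also have "\<dots> = (\<Sum>i\<in>UNIV. \<Sum>j\<in>UNIV. \<Sum>k\<in>UNIV. \<Sum>l\<in>UNIV.
       partial_entry i j (partial_entry k l w) F * a $ i * b $ j * a $ k * b $ l)"
      by (intro sum.cong refl) (simp add: partial_entry_def unit_mat_def[symmetric] w''_eq[OF F] outer_def)
    finally show ?thesis ..
  qed
  then show ?thesis by (simp add: rank_one_convex_def)
qed

text \<open>
  A factorization \<open>F = P ** diag_mat y ** Q\<close> transports the second derivative from \<open>F\<close> to
  \<open>diag_mat y\<close>, and it carries rank one directions to rank one directions.
\<close>

lemma rank_one_convex_iff_diag:
  "rank_one_convex w \<longleftrightarrow> (\<forall>y\<in>pos_orthant. \<forall>a b. w'' (diag_mat y) (outer a b) (outer a b) \<ge> 0)"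
  unfolding rank_one_convex_iff
proof (intro iffI ballI allI)
  fix F :: "real^'n^'n" and a b :: "real^'n"
  assume diag: "\<forall>y\<in>pos_orthant. \<forall>a b. 0 \<le> w'' (diag_mat y) (outer a b) (outer a b)" and "F \<in> GL_pos"
  then obtain P Q y where PQ: "rotation_matrix P" "rotation_matrix Q" and y: "y \<in> pos_orthant"
    and F: "F = P ** diag_mat y ** Q"
    using singular_value_decomposition by metis
  let ?a = "transpose P *v a" and ?b = "Q *v b"
  have "outer a b = P ** outer ?a ?b ** Q"
    using PQ by (simp add: mult_outer_mult matrix_vector_mul_assoc rotation_matrix_def orthogonal_matrix_def
        del: transpose_matrix_vector)
  then show "0 \<le> w'' F (outer a b) (outer a b)"
    using w''_rotate[OF PQ GL_pos_diag_mat[OF y], of "outer ?a ?b" "outer ?a ?b"] diag y F by simp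
qed (simp add: GL_pos_diag_mat)

lemma second_derivative_rank_one:
  assumes y: "y \<in> pos_orthant"
  shows "w'' (diag_mat y) (outer a b) (outer a b) =
    (\<Sum>i\<in>UNIV. \<Sum>j\<in>UNIV. H_matrix g y $ i $ j * (a $ i * b $ i) * (a $ j * b $ j)) +
    (\<Sum>i\<in>UNIV. \<Sum>j\<in>UNIV. G_matrix g y $ i $ j * (a $ i * b $ j)\<^sup>2)"
  unfolding second_derivative_formula[OF y] sum.distrib[symmetric]
  by (intro sum.cong refl) (simp add: outer_def H_matrix_def algebra_simps)

lemma G_symmetric:
  assumes y: "y \<in> pos_orthant"
  shows "G_matrix g y $ j $ i = G_matrix g y $ i $ j"
proof (cases "y $ i = y $ j")
  case True
  have "hessian g y $ j $ j = hessian g y $ i $ i" "hessian g y $ j $ i = hessian g y $ i $ j"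
    using g''_swap_entries[OF y True, of "axis i 1" "axis i 1"] g''_swap_entries[OF y True, of "axis i 1" "axis j 1"]
    by (simp_all add: hessian_eq[OF y] swap_entries_axis swap_entries_axis')
  with True partial_swap[OF y True] show ?thesis
    unfolding G_matrix_def by simp
next
  case False
  have "(y $ j * q - y $ i * r) / ((y $ j)\<^sup>2 - (y $ i)\<^sup>2) = (y $ i * r - y $ j * q) / ((y $ i)\<^sup>2 - (y $ j)\<^sup>2)" for q r
    using minus_divide_divide[of "y $ i * r - y $ j * q" "(y $ i)\<^sup>2 - (y $ j)\<^sup>2"]
    by (simp only: minus_diff_eq)
  with False show ?thesis by (auto simp: G_matrix_def)
qed

text \<open>
  The term \<open>(a $ i * b $ j)\<^sup>2\<close>, averaged over the exchange of \<open>i\<close> and \<open>j\<close>, is compared with a product by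
  the inequality between the arithmetic and the geometric mean. Equality holds for
  \<open>\<bar>a $ i\<bar> = \<bar>b $ i\<bar>\<close>, which is the choice made in the converse below.
\<close>

lemma rank_one_form_ge:
  assumes y: "y \<in> pos_orthant" and G: "\<And>i j. G_matrix g y $ i $ j \<ge> 0"
  shows "(\<Sum>i\<in>UNIV. \<Sum>j\<in>UNIV. G_matrix g y $ i $ j * \<bar>a $ i * b $ i\<bar> * \<bar>a $ j * b $ j\<bar>)
    \<le> (\<Sum>i\<in>UNIV. \<Sum>j\<in>UNIV. G_matrix g y $ i $ j * (a $ i * b $ j)\<^sup>2)" (is "?L \<le> ?R")
proof -
  have "2 * ?L = (\<Sum>i\<in>UNIV. \<Sum>j\<in>UNIV. G_matrix g y $ i $ j * (2 * \<bar>a $ i * b $ j\<bar> * \<bar>a $ j * b $ i\<bar>))"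
    by (simp add: sum_distrib_left abs_mult mult_ac)
  also have "\<dots> \<le> (\<Sum>i\<in>UNIV. \<Sum>j\<in>UNIV. G_matrix g y $ i $ j * ((a $ i * b $ j)\<^sup>2 + (a $ j * b $ i)\<^sup>2))"
  proof (intro sum_mono mult_left_mono G)
    show "2 * \<bar>a $ i * b $ j\<bar> * \<bar>a $ j * b $ i\<bar> \<le> (a $ i * b $ j)\<^sup>2 + (a $ j * b $ i)\<^sup>2" for i j
      using sum_squares_bound[of "\<bar>a $ i * b $ j\<bar>" "\<bar>a $ j * b $ i\<bar>"] by simp
  qed
  also have "\<dots> = ?R + (\<Sum>i\<in>UNIV. \<Sum>j\<in>UNIV. G_matrix g y $ j $ i * (a $ j * b $ i)\<^sup>2)"
    by (simp add: distrib_left sum.distrib G_symmetric[OF y])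
  also have "\<dots> = ?R + ?R"
    using sum.swap[of "\<lambda>i j. G_matrix g y $ j $ i * (a $ j * b $ i)\<^sup>2" UNIV UNIV] by simp
  finally show ?thesis by simp
qed

text \<open>
  Given \<open>x\<close>, the vectors \<open>a\<close> and \<open>b\<close> with \<open>\<bar>a $ i\<bar> = \<bar>b $ i\<bar> = sqrt \<bar>x $ i\<bar>\<close> and \<open>a $ i * b $ i = x $ i\<close>
  turn rank one convexity into the copositivity condition, and coordinate vectors isolate the single
  entry \<open>G_matrix g y $ i $ j\<close>. Conversely Schur convexity makes the entries of \<open>G_matrix\<close> nonnegative,
  so the form at \<open>a\<close>, \<open>b\<close> is bounded below by the one at \<open>x $ i = a $ i * b $ i\<close>.
\<close>

lemma rank_one_convex_characterization:
  assumes h: "\<And>x. h x = g (\<chi> i. exp (x $ i))"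
  shows "rank_one_convex w \<longleftrightarrow> schur_convex h \<and>
     (\<forall>y\<in>pos_orthant. \<forall>x.
        (\<Sum>i\<in>UNIV. \<Sum>j\<in>UNIV. H_matrix g y $ i $ j * x $ i * x $ j) +
        (\<Sum>i\<in>UNIV. \<Sum>j\<in>UNIV. G_matrix g y $ i $ j * \<bar>x $ i\<bar> * \<bar>x $ j\<bar>) \<ge> 0)"
    (is "_ \<longleftrightarrow> _ \<and> ?B")
proof
  assume "rank_one_convex w"
  then have form: "0 \<le> (\<Sum>i\<in>UNIV. \<Sum>j\<in>UNIV. H_matrix g y $ i $ j * (a $ i * b $ i) * (a $ j * b $ j)) +
    (\<Sum>i\<in>UNIV. \<Sum>j\<in>UNIV. G_matrix g y $ i $ j * (a $ i * b $ j)\<^sup>2)"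
    if "y \<in> pos_orthant" for y a b
    using that by (simp add: rank_one_convex_iff_diag second_derivative_rank_one)
  have "G_matrix g y $ i $ j \<ge> 0" if "y \<in> pos_orthant" "i \<noteq> j" for y i j
  proof -
    have 1: "(axis i 1 :: real^'n) $ k * axis j 1 $ k = 0" for k
      using that(2) by (simp add: axis_def)
    have 2: "((axis i 1 :: real^'n) $ k * axis j 1 $ l)\<^sup>2 = (if k = i then if l = j then 1 else 0 else 0)" for k l
      by (simp add: axis_def)
    have 3: "(\<Sum>l\<in>UNIV. G_matrix g y $ k $ l * (if k = i then if l = j then 1 else 0 else 0)) =
       (if k = i then G_matrix g y $ i $ j else 0)" for k
      by (simp add: if_distrib[of "\<lambda>t. _ * t"] cong: if_cong)
    show ?thesis
      using form[OF that(1), of "axis i 1" "axis j 1"] by (simp only: 1 2 3) simp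
  qed
  then have "schur_convex h" by (rule schur_convex_if_G_nonneg[OF h])
  moreover have ?B
  proof (intro ballI allI)
    fix y x :: "real^'n" assume y: "y \<in> pos_orthant"
    define a :: "real^'n" where "a = (\<chi> i. sqrt \<bar>x $ i\<bar>)"
    define b :: "real^'n" where "b = (\<chi> i. sgn (x $ i) * sqrt \<bar>x $ i\<bar>)"
    have "a $ i * b $ i = x $ i" for i
      by (simp add: a_def b_def mult.left_commute sgn_mult_abs)
    moreover have "(a $ i * b $ j)\<^sup>2 = \<bar>x $ i\<bar> * \<bar>x $ j\<bar>" for i j
      by (cases "x $ j = 0") (simp_all add: a_def b_def power_mult_distrib sgn_if)
    ultimately show "0 \<le> (\<Sum>i\<in>UNIV. \<Sum>j\<in>UNIV. H_matrix g y $ i $ j * x $ i * x $ j) +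
        (\<Sum>i\<in>UNIV. \<Sum>j\<in>UNIV. G_matrix g y $ i $ j * \<bar>x $ i\<bar> * \<bar>x $ j\<bar>)"
      using form[OF y, of a b] by (simp add: mult.assoc)
  qed
  ultimately show "schur_convex h \<and> ?B" ..
next
  assume ab: "schur_convex h \<and> ?B"
  show "rank_one_convex w"
    unfolding rank_one_convex_iff_diag
  proof (intro ballI allI)
    fix y a b :: "real^'n" assume y: "y \<in> pos_orthant"
    have "G_matrix g y $ i $ j \<ge> 0" for i j
      using G_nonneg_if_schur_convex[OF h _ y] ab by blast
    from rank_one_form_ge[OF y this, of a b]
    show "0 \<le> w'' (diag_mat y) (outer a b) (outer a b)"
      using bspec[OF conjunct2[OF ab] y, THEN spec, of "\<chi> i. a $ i * b $ i"]
      by (simp add: second_derivative_rank_one[OF y])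
  qed
qed

end

theorem theorem5p1:
  fixes w :: "real^'n^'n \<Rightarrow> real" and g :: "real^'n \<Rightarrow> real" and h :: "real^'n \<Rightarrow> real"
  assumes w_C2: "C2_on GL_pos w"
    and w_objective: "objective w"
    and w_isotropic: "isotropic w"
    and g_symmetric: "symmetric_on_pos g"
    and g_C2: "C2_on pos_orthant g"
    and w_eq: "\<And>F. F \<in> GL_pos \<Longrightarrow> w F = g (singular_values F)"
    and h_eq: "\<And>x. h x = g (\<chi> i. exp (x $ i))"
  shows "rank_one_convex w \<longleftrightarrow>
     schur_convex h \<and>
     (\<forall>y\<in>pos_orthant. \<forall>x::real^'n.
        (\<Sum>i\<in>UNIV. \<Sum>j\<in>UNIV. H_matrix g y $ i $ j * x $ i * x $ j) +
        (\<Sum>i\<in>UNIV. \<Sum>j\<in>UNIV. G_matrix g y $ i $ j * \<bar>x $ i\<bar> * \<bar>x $ j\<bar>) \<ge> 0)"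
proof -
  obtain w' w'' where w: "\<forall>F\<in>GL_pos. (w has_derivative blinfun_apply (w' F)) (at F)"
    "\<forall>F\<in>GL_pos. (w' has_derivative blinfun_apply (w'' F)) (at F)" "continuous_on GL_pos w''"
    using w_C2 unfolding C2_on_def by blast
  obtain g' g'' where g: "\<forall>y\<in>pos_orthant. (g has_derivative blinfun_apply (g' y)) (at y)"
    "\<forall>y\<in>pos_orthant. (g' has_derivative blinfun_apply (g'' y)) (at y)" "continuous_on pos_orthant g''"
    using g_C2 unfolding C2_on_def by blast
  have "w (diag_mat y) = g y" if y: "y \<in> pos_orthant" for y
  proof -
    obtain p where "bij p" "singular_values (diag_mat y) = (\<chi> i. y $ p i)"
      using singular_values_diag_mat[OF y] by blast
    then show ?thesis
      using g_symmetric y by (simp add: w_eq[OF GL_pos_diag_mat[OF y]] symmetric_on_pos_def)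
  qed
  then interpret isotropic_function w w' w'' g g' g''
    using w g w_objective w_isotropic g_symmetric by unfold_locales auto
  show ?thesis
    by (rule rank_one_convex_characterization[OF h_eq])
qed

end
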